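(* Let $n$ be a positive integer. (1) If $n\neq 3$, then $\Theta_n(\boldsymbol{a})=\Theta_n$ for every $\boldsymbol{a}\in\mathbb{Z}^n\setminus\{\boldsymbol{0}\}$. That is, for each nonzero integer vector $\boldsymbol{a}\in\mathbb{Z}^n$ and each $\theta\in\Theta_n$ there is a nonzero integer vector $\boldsymbol{b}\in\mathbb{Z}^n$ with $\angle(\boldsymbol{a},\boldsymbol{b})=\theta$. (2) If $n=3$, then $\Theta_3(\boldsymbol{a})\subsetneq\Theta_3$ for every $\boldsymbol{a}\in\mathbb{Z}^3\setminus\{\boldsymbol{0}\}$. That is, for each nonzero integer vector $\boldsymbol{a}\in\mathbb{Z}^3$ there is an angle $\theta\in\Theta_3$ such that $\angle(\boldsymbol{a},\boldsymbol{b})\neq\theta$ for every nonzero integer vector $\boldsymbol{b}\in\mathbb{Z}^3$.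
   Context: For nonzero $\boldsymbol{a},\boldsymbol{b}\in\mathbb{R}^n$, $\angle(\boldsymbol{a},\boldsymbol{b}):=\arccos\dfrac{\boldsymbol{a}\cdot\boldsymbol{b}}{\|\boldsymbol{a}\|\,\|\boldsymbol{b}\|}\in[0,\pi]$, with the standard scalar product and Euclidean norm. $\Theta_n:=\{\angle(\boldsymbol{a},\boldsymbol{b})\mid \boldsymbol{a},\boldsymbol{b}\in\mathbb{Z}^n\setminus\{\boldsymbol{0}\}\}$ is the set of lattice angles in $\mathbb{Z}^n$. For $\boldsymbol{a}\in\mathbb{Z}^n\setminus\{\boldsymbol{0}\}$, $\Theta_n(\boldsymbol{a}):=\{\angle(\boldsymbol{a},\boldsymbol{b})\mid \boldsymbol{b}\in\mathbb{Z}^n\setminus\{\boldsymbol{0}\}\}$. *)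

theory Defs
  imports "HOL-Analysis.Analysis"
begin

text \<open>
  The dimension \<open>n\<close> is the cardinality \<open>CARD('n)\<close> of the index type of \<open>real ^ 'n\<close>; types are
  nonempty, so \<open>n \<ge> 1\<close> holds automatically.
\<close>

text \<open>Only meaningful for nonzero arguments; it is never used for zero vectors below.\<close>

definition vec_angle :: "real ^ 'n \<Rightarrow> real ^ 'n \<Rightarrow> real" where
  "vec_angle a b = arccos (a \<bullet> b / (norm a * norm b))"

definition nonzero_int_vecs :: "(real ^ 'n) set" where
  "nonzero_int_vecs = {a. \<forall>i. a $ i \<in> \<int>} - {0}"

text \<open>The set \<open>\<Theta>\<^sub>n\<close> depends only on the dimension, hence the \<open>itself\<close> argument.\<close>

definition lattice_angles :: "'n::finite itself \<Rightarrow> real set" where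
  "lattice_angles _ =
     {vec_angle a b | a b :: real ^ 'n. a \<in> nonzero_int_vecs \<and> b \<in> nonzero_int_vecs}"

definition lattice_angles_at :: "real ^ 'n \<Rightarrow> real set" where
  "lattice_angles_at a = {vec_angle a b | b. b \<in> nonzero_int_vecs}"

end

theory Submission
  imports Defs "HOL-Real_Asymp.Real_Asymp" "HOL-Number_Theory.Number_Theory"
    "HOL-Computational_Algebra.Squarefree"
begin

text \<open>
  An angle is determined by the sign of the scalar product and by \<open>tan\<^sup>2\<close>, so for \<open>c = u \<bullet> v\<close> and the
  Gram determinant \<open>D = |u|\<^sup>2 |v|\<^sup>2 - c\<^sup>2\<close> the angle between \<open>u\<close> and \<open>v\<close> is realized at \<open>a\<close> by \<open>c a + w\<close> as
  soon as a rational \<open>w\<close> satisfies \<open>w \<bullet> a = 0\<close> and \<open>|w|\<^sup>2 = |a|\<^sup>2 D\<close>. For \<open>n = 2\<close> and \<open>n = 4\<close> such a \<open>w\<close> is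
  the product of \<open>a\<close> with the imaginary part of \<open>u\<^sup>* v\<close> in the complex numbers resp. the quaternions;
  for \<open>n = 1\<close> one has \<open>D = 0\<close>.

  For \<open>n \<ge> 5\<close> it suffices, up to a rational reflection, to find orthogonal vectors of given norms \<open>A\<close> and \<open>B\<close>
  in \<open>\<rat>\<^sup>5\<close>. By quaternions this means that \<open>A B - A y\<^sup>2 - B x\<^sup>2\<close> is a sum of three rational squares for some
  rational \<open>x, y\<close> with \<open>x\<^sup>2 < A\<close>; these can be chosen such that the number is a rational square times an integer
  \<open>n \<equiv> 1 (mod 4)\<close>. For squarefree such \<open>n\<close> there is a prime \<open>q \<equiv> 1 (mod 4)\<close> for which \<open>-q\<close> is a square
  modulo \<open>n\<close> (Dirichlet's argument, needed for real characters only). By reciprocity \<open>n\<close> is a square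
  modulo \<open>q\<close>, so \<open>n X\<^sup>2 = Y\<^sup>2 + q Z\<^sup>2\<close> is solvable, and \<open>q\<close> is a sum of two squares.

  For \<open>n = 3\<close> the vector \<open>w = c (a \<times> b)\<close> is orthogonal to \<open>a\<close> and has norm \<open>D\<close> times a square. For suitable
  \<open>D\<close>, depending on \<open>a\<close>, this is impossible modulo 8.
\<close>

section \<open>Primes with prescribed values of real characters\<close>

text \<open>Summation by parts: sums of \<open>a\<close> starting at \<open>m\<close> are
  differences of two initial sums, whence the factor 2, and the differences of \<open>b\<close>
  telescope.\<close>

lemma abel_bound:
  fixes a b :: "nat \<Rightarrow> real"
  assumes K: "\<And>n. \<bar>sum a {..<n}\<bar> \<le> K"
    and dec: "\<And>i. i \<ge> m \<Longrightarrow> b (Suc i) \<le> b i" and nn: "\<And>i. i \<ge> m \<Longrightarrow> 0 \<le> b i"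
  shows "\<bar>\<Sum>i=m..<n. a i * b i\<bar> \<le> 2 * K * b m"
proof (cases "m \<le> n")
  case True
  define A where "A j = sum a {..<j} - sum a {..<m}" for j
  have A: "\<bar>A j\<bar> \<le> 2 * K" for j
    using K[of j] K[of m] unfolding A_def by linarith
  have eq: "(\<Sum>i=m..<n. a i * b i) = (\<Sum>i=m..<n. A (Suc i) * (b i - b (Suc i))) + A n * b n"
    using True
  proof (induction n rule: dec_induct)
    case base
    then show ?case by (simp add: A_def)
  next
    case (step n)
    have "A (Suc n) = A n + a n" by (simp add: A_def)
    with step show ?case by (simp add: algebra_simps)
  qed
  have "\<bar>\<Sum>i=m..<n. a i * b i\<bar> \<le> (\<Sum>i=m..<n. \<bar>A (Suc i) * (b i - b (Suc i))\<bar>) + \<bar>A n * b n\<bar>"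
    unfolding eq by (intro order.trans[OF abs_triangle_ineq] add_mono sum_abs order_refl)
  also have "\<dots> \<le> (\<Sum>i=m..<n. 2 * K * (b i - b (Suc i))) + 2 * K * b n"
  proof (intro add_mono sum_mono)
    fix i assume "i \<in> {m..<n}"
    then show "\<bar>A (Suc i) * (b i - b (Suc i))\<bar> \<le> 2 * K * (b i - b (Suc i))"
      using dec[of i] A[of "Suc i"] by (auto simp: abs_mult intro!: mult_right_mono)
  next
    show "\<bar>A n * b n\<bar> \<le> 2 * K * b n"
      using nn[of n] True A[of n] by (auto simp: abs_mult intro!: mult_right_mono)
  qed
  also have "(\<Sum>i=m..<n. 2 * K * (b i - b (Suc i))) = 2 * K * (b m - b n)"
    using True sum_Suc_diff'[of m n b]
    by (simp add: sum_distrib_left [symmetric] sum_subtractf)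
  finally show ?thesis by (simp add: algebra_simps)
next
  case False
  then show ?thesis using K[of 0] nn[of m] by simp
qed

text \<open>A real Dirichlet character whose values at arguments sharing a factor with
  \<open>M\<close> are left open; the constant 1 thus counts for every positive modulus.\<close>

definition real_char :: "nat \<Rightarrow> (nat \<Rightarrow> real) \<Rightarrow> bool" where
  "real_char M f \<longleftrightarrow> M > 0 \<and> f 1 = 1 \<and> (\<forall>m n. f (m * n) = f m * f n) \<and>
     (\<forall>n. f (n + M) = f n) \<and> (\<forall>n. f n \<in> {-1, 0, 1}) \<and> (\<forall>n. f n = 0 \<longrightarrow> \<not> coprime n M)"

lemma real_charD:
  assumes "real_char M f"
  shows "M > 0" "f (Suc 0) = 1" "f (m * n) = f m * f n" "f (n + M) = f n"
    "f n \<in> {-1, 0, 1}" "\<bar>f n\<bar> \<le> 1" "f n = 0 \<Longrightarrow> \<not> coprime n M"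
proof -
  show "f n \<in> {-1, 0, 1}" using assms by (auto simp: real_char_def)
  then show "\<bar>f n\<bar> \<le> 1" by auto
qed (use assms in \<open>auto simp: real_char_def\<close>)

lemma real_char_power: "real_char M f \<Longrightarrow> f (n ^ k) = f n ^ k"
  by (induction k) (auto simp: real_charD)

lemma real_char_mod:
  assumes "real_char M f" shows "f (n mod M) = f n"
proof -
  have "f (m + M * k) = f m" for m k
  proof (induction k)
    case (Suc k)
    then show ?case using real_charD(4)[OF assms, of "m + M * k"] by (simp add: algebra_simps)
  qed simp
  from this[of "n mod M" "n div M"] show ?thesis by simp
qed

lemma real_char_prod:
  assumes "finite S" "\<And>i. i \<in> S \<Longrightarrow> real_char (M i) (f i)"
  shows "real_char (\<Prod>i\<in>S. M i) (\<lambda>n. \<Prod>i\<in>S. f i n)"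
proof -
  have per: "f i (n + (\<Prod>i\<in>S. M i)) = f i n" if "i \<in> S" for i n
  proof -
    have "M i dvd (\<Prod>i\<in>S. M i)" using assms(1) that by (rule dvd_prodI)
    then have "(n + (\<Prod>i\<in>S. M i)) mod M i = n mod M i" by (auto simp: dvd_def)
    then show ?thesis using real_char_mod[OF assms(2)[OF that]] by metis
  qed
  have "(\<Prod>i\<in>T. f i n) \<in> {-1, 0, 1}" if "T \<subseteq> S" for T n
    using finite_subset[OF that assms(1)] that
  proof (induction T rule: finite_induct)
    case (insert i T)
    then show ?case using real_charD(5)[OF assms(2)[of i], of n] by auto
  qed auto
  moreover have "\<not> coprime n (\<Prod>i\<in>S. M i)" if z: "(\<Prod>i\<in>S. f i n) = 0" for n
  proof -
    obtain i where i: "i \<in> S" "f i n = 0" using z assms(1) by auto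
    have "M i dvd (\<Prod>i\<in>S. M i)" using assms(1) i(1) by (rule dvd_prodI)
    then show ?thesis using real_charD(7)[OF assms(2)[OF i(1)] i(2)]
      by (meson coprime_divisors dvd_refl)
  qed
  moreover have "(\<Prod>i\<in>S. M i) > 0" "(\<Prod>i\<in>S. f i 1) = 1"
    using real_charD(1,2)[OF assms(2)] by (auto intro!: prod_pos prod.neutral)
  moreover have "(\<Prod>i\<in>S. f i (m * n)) = (\<Prod>i\<in>S. f i m) * (\<Prod>i\<in>S. f i n)" for m n
    unfolding prod.distrib [symmetric] using real_charD(3)[OF assms(2)] by (intro prod.cong) auto
  moreover have "(\<Prod>i\<in>S. f i (n + (\<Prod>i\<in>S. M i))) = (\<Prod>i\<in>S. f i n)" for n
    using per by (intro prod.cong) auto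
  ultimately show ?thesis unfolding real_char_def by blast
qed

text \<open>Multiplication by \<open>b\<close> permutes the residues modulo \<open>M\<close> and
  flips the sign of \<open>f\<close>, so a full period sums to 0. What remains is an incomplete
  period of terms of absolute value at most 1.\<close>

lemma real_char_sum_bound:
  assumes f: "real_char M f" and b: "f b = -1" and cop: "coprime b M"
  shows "\<bar>sum f {..<n}\<bar> \<le> M"
proof -
  note [simp] = real_charD[OF f]
  have M: "M > 0" by simp
  have inj: "inj_on (\<lambda>m. b * m mod M) {..<M}"
  proof (rule inj_onI)
    fix x y assume "x \<in> {..<M}" "y \<in> {..<M}" "b * x mod M = b * y mod M"
    then have "[x = y] (mod M)" using cop by (simp add: cong_def cong_mult_lcancel_nat[unfolded cong_def])
    with \<open>x \<in> _\<close> \<open>y \<in> _\<close> show "x = y" by (simp add: cong_def)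
  qed
  have img: "(\<lambda>m. b * m mod M) ` {..<M} = {..<M}"
    by (rule card_subset_eq) (use M inj in \<open>auto simp: card_image\<close>)
  have "sum f {..<M} = sum f ((\<lambda>m. b * m mod M) ` {..<M})" by (simp only: img)
  also have "\<dots> = (\<Sum>m<M. f (b * m))"
    by (simp add: sum.reindex[OF inj] real_char_mod[OF f])
  also have "\<dots> = - sum f {..<M}" by (simp add: b sum_negf)
  finally have z: "sum f {..<M} = 0" by simp
  have per: "sum f {..<r + M * k} = sum f {..<r}" for r k
  proof (induction k)
    case (Suc k)
    have *: "sum f {..<M + j} = sum f {..<M} + sum f {..<j}" for j
      by (induction j) (auto simp: add.commute[of M])
    have "sum f {..<r + M * Suc k} = sum f {..<M + (r + M * k)}" by (simp add: algebra_simps)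
    then show ?case using Suc z * by simp
  qed simp
  have "\<bar>sum f {..<n}\<bar> = \<bar>sum f {..<n mod M}\<bar>" using per[of "n mod M" "n div M"] by simp
  also have "\<dots> \<le> (\<Sum>i<n mod M. \<bar>f i\<bar>)" by (rule sum_abs)
  also have "\<dots> \<le> (\<Sum>i<n mod M. 1)" by (intro sum_mono) simp
  also have "\<dots> \<le> M" using M by (simp add: less_imp_le)
  finally show ?thesis .
qed

text \<open>
  Monsky's proof that \<open>L(1, f) \<noteq> 0\<close>: if \<open>L(1, f) = 0\<close>, the Lambert series of \<open>f\<close> stays bounded as \<open>x\<close> tends
  to \<open>1\<close>; but its power series coefficients \<open>\<Sum>d | d dvd m. f d\<close> are nonnegative, and at least \<open>1\<close> for square \<open>m\<close>.
\<close>

lemma geometric_sum_ge: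
  fixes y :: real assumes "y \<ge> 0"
  shows "(\<Sum>i<Suc n. (y\<^sup>2) ^ i) \<ge> real (Suc n) * y ^ n"
proof -
  \<comment> \<open>Add the sum to its own reversal and apply AM-GM to each pair.\<close>
  have "2 * (\<Sum>i<Suc n. (y\<^sup>2) ^ i) = (\<Sum>i<Suc n. (y\<^sup>2) ^ i) + (\<Sum>i<Suc n. (y\<^sup>2) ^ (n - i))"
    using sum.nat_diff_reindex[of "\<lambda>i. (y\<^sup>2) ^ i" "Suc n"] by simp
  also have "\<dots> = (\<Sum>i<Suc n. (y\<^sup>2) ^ i + (y\<^sup>2) ^ (n - i))" by (simp add: sum.distrib)
  also have "\<dots> \<ge> (\<Sum>i<Suc n. 2 * y ^ n)"
  proof (rule sum_mono)
    fix i assume "i \<in> {..<Suc n}"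
    then have n: "y ^ n = y ^ i * y ^ (n - i)" by (simp flip: power_add)
    have "(y ^ i - y ^ (n - i))\<^sup>2 \<ge> 0" by simp
    then show "2 * y ^ n \<le> (y\<^sup>2) ^ i + (y\<^sup>2) ^ (n - i)"
      unfolding n by (simp add: power2_diff power_mult [symmetric] mult.commute algebra_simps)
  qed
  finally show ?thesis by simp
qed

text \<open>With \<open>G n\<close> the sum of \<open>x ^ i\<close> over \<open>i < n\<close>, one
  has \<open>(1 - x) * b n = 1 / n - x ^ n / G n\<close>, and this drops by
  \<open>1 / (n * (n + 1)) - x ^ n / (G n * G (Suc n))\<close> in one step. Both claims therefore
  reduce to lower bounds for \<open>G\<close>. Monotonicity allows Abel summation when the Lambert
  series is compared with L(1, f).\<close>

lemma monsky_decreasing: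
  fixes x :: real assumes x: "0 < x" "x < 1"
  defines "b \<equiv> \<lambda>n. 1 / (real n * (1 - x)) - x ^ n / (1 - x ^ n)"
  assumes "n \<ge> 1"
  shows "b (Suc n) \<le> b n" "0 \<le> b n"
proof -
  define G where "G n = (\<Sum>i<n. x ^ i)" for n
  define y where "y = sqrt x"
  have y: "0 < y" "y < 1" "x = y\<^sup>2" using x by (auto simp: y_def)
  have G: "1 - x ^ k = (1 - x) * G k" for k by (simp add: G_def one_diff_power_eq)
  have Gge: "G (Suc k) \<ge> real (Suc k) * y ^ k" for k
    unfolding G_def y(3) by (rule geometric_sum_ge) (use y in auto)
  have Gpos: "G k > 0" if "k \<ge> 1" for k
    using Gge[of "k - 1"] that y by (smt (verit) One_nat_def Suc_pred' less_eq_Suc_le mult_pos_pos of_nat_0_less_iff zero_less_power)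
  have GS: "G (Suc n) = 1 + x * G n"
    unfolding G_def sum.lessThan_Suc_shift by (simp add: sum_distrib_left)
  have b: "(1 - x) * b k = 1 / k - x ^ k / G k" if "k \<ge> 1" for k
  proof -
    have "(1 - x) * (1 / (k * (1 - x))) = 1 / k" using x by simp
    moreover have "(1 - x) * (x ^ k / ((1 - x) * G k)) = x ^ k / G k" using x by simp
    ultimately show ?thesis unfolding b_def G by (simp only: right_diff_distrib)
  qed
  obtain k where n: "n = Suc k" using \<open>n \<ge> 1\<close> by (cases n) auto
  \<comment> \<open>By \<open>geometric_sum_ge\<close> the product \<open>G n * G (Suc n)\<close> is
    at least n(n+1) times \<open>y\<close> to the power 2n-1, and that power is at least
    \<open>x ^ n = y ^ (2 * n)\<close>.\<close>
  have "real n * (n + 1) * x ^ n \<le> real n * (n + 1) * (y ^ k * y ^ n)"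
  proof (intro mult_left_mono)
    have "x ^ n = y ^ (2 * n)" by (simp add: y(3) power_mult)
    also have "\<dots> \<le> y ^ (k + n)" using y n by (intro power_decreasing) auto
    finally show "x ^ n \<le> y ^ k * y ^ n" by (simp add: power_add)
  qed auto
  also have "\<dots> = (real (Suc k) * y ^ k) * (real (Suc n) * y ^ n)" by (simp add: n)
  also have "\<dots> \<le> G (Suc k) * G (Suc n)"
    using y by (intro mult_mono Gge) (auto intro: order.trans[OF _ Gge])
  finally have key: "real n * (n + 1) * x ^ n \<le> G n * G (Suc n)" by (simp add: n)
  have "(1 - x) * b n - (1 - x) * b (Suc n) = 1 / (real n * (n + 1)) - x ^ n / (G n * G (Suc n))"
  proof -
    have "x ^ n / G n - x ^ Suc n / G (Suc n) = x ^ n * (G (Suc n) - x * G n) / (G n * G (Suc n))"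
      using Gpos[of n] Gpos[of "Suc n"] \<open>n \<ge> 1\<close> by (simp add: field_simps)
    also have "\<dots> = x ^ n / (G n * G (Suc n))" by (simp add: GS)
    finally have 1: "x ^ n / G n - x ^ Suc n / G (Suc n) = x ^ n / (G n * G (Suc n))" .
    have 2: "1 / real n - 1 / real (Suc n) = 1 / (real n * (n + 1))"
      using \<open>n \<ge> 1\<close> by (simp add: field_simps)
    show ?thesis using 1 2 b[of n] b[of "Suc n"] \<open>n \<ge> 1\<close> by linarith
  qed
  also have "\<dots> \<ge> 0"
    using key \<open>n \<ge> 1\<close> Gpos[of n] Gpos[of "Suc n"] by (simp add: divide_simps mult.commute)
  finally have "(1 - x) * b (Suc n) \<le> (1 - x) * b n" by simp
  then show "b (Suc n) \<le> b n" using x by simp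
  have "real n * y ^ k \<le> G n" using Gge[of k] n by simp
  moreover have "real n * x ^ n \<le> real n * y ^ k"
  proof (intro mult_left_mono)
    have "x ^ n = y ^ (2 * n)" by (simp add: y(3) power_mult)
    also have "\<dots> \<le> y ^ k" using y n by (intro power_decreasing) auto
    finally show "x ^ n \<le> y ^ k" .
  qed auto
  ultimately have "real n * x ^ n \<le> G n" by linarith
  then have "0 \<le> (1 - x) * b n" unfolding b[OF \<open>n \<ge> 1\<close>]
    using \<open>n \<ge> 1\<close> Gpos[of n] by (simp add: field_simps)
  then show "0 \<le> b n" using x by (simp add: zero_le_mult_iff)
qed

section \<open>Lambert series and divisor sums of a real character\<close>

lemma divisor_sums:
  fixes x :: real assumes x: "0 < x" "x < 1" and n: "n \<ge> 1"
  shows "(\<lambda>m. if n dvd m \<and> m > 0 then x ^ m else 0) sums (x ^ n / (1 - x ^ n))"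
proof -
  have "(\<lambda>j. (x ^ n) ^ j) sums (1 / (1 - x ^ n))"
    using x n by (intro geometric_sums) (auto simp: power_less_one_iff)
  from sums_mult[OF this, of "x ^ n"]
  have "(\<lambda>j. x ^ (n * Suc j)) sums (x ^ n / (1 - x ^ n))" by (simp add: power_add power_mult)
  then have *: "(\<lambda>j. (\<lambda>m. if n dvd m \<and> m > 0 then x ^ m else 0) (n * Suc j)) sums (x ^ n / (1 - x ^ n))"
    using n by simp
  have mono: "strict_mono (\<lambda>j. n * Suc j)" using n by (auto simp: strict_mono_Suc_iff)
  have zero: "(if n dvd m \<and> m > 0 then x ^ m else 0) = 0" if m: "m \<notin> range (\<lambda>j. n * Suc j)" for m
  proof -
     have False if "n dvd m" "m > 0"
    proof -
      from that obtain k where "m = n * k" "k > 0" by auto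
      then have "m = n * Suc (k - 1)" by simp
      then show False using m by blast
    qed
    then show ?thesis by auto
  qed
  show ?thesis
    using sums_mono_reindex[OF mono, of "\<lambda>m. if n dvd m \<and> m > 0 then x ^ m else 0"] zero * by simp
qed

text \<open>Each divisor of \<open>p ^ k * m\<close> is \<open>p ^ j * d\<close> with
  \<open>j \<le> k\<close> and \<open>d dvd m\<close> in exactly one way, so multiplicativity of
  \<open>f\<close> splits the sum.\<close>

lemma divisor_sum_prime_power:
  fixes p :: nat assumes f: "real_char M f" and p: "prime p" and m: "\<not> p dvd m" "m > 0"
  shows "(\<Sum>d | d dvd p ^ k * m. f d) = (\<Sum>j\<le>k. f p ^ j) * (\<Sum>d | d dvd m. f d)"
proof -
  have cop: "coprime p m" using p m(1) by (simp add: prime_imp_coprime)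
  have inj: "inj_on (\<lambda>(j, d). p ^ j * d) ({..k} \<times> {d. d dvd m})"
  proof (rule inj_onI, clarify)
    fix j d j' d' assume a: "d dvd m" "d' dvd m" "p ^ j * d = p ^ j' * d'"
    have nd: "\<not> p dvd d" "\<not> p dvd d'" using a m dvd_trans by blast+
    have "d > 0" "d' > 0" using a m by (auto intro: Nat.gr0I)
    have "multiplicity p (p ^ j * d) = j" "multiplicity p (p ^ j' * d') = j'"
      using nd p by (auto simp: prime_elem_multiplicity_mult_distrib \<open>d > 0\<close> \<open>d' > 0\<close> not_dvd_imp_multiplicity_0)
    then have "j = j'" using a by simp
    with a p show "j = j' \<and> d = d'" by simp
  qed
  have img: "(\<lambda>(j, d). p ^ j * d) ` ({..k} \<times> {d. d dvd m}) = {d. d dvd p ^ k * m}"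
  proof (intro equalityI subsetI)
    fix x assume "x \<in> {d. d dvd p ^ k * m}"
    then have "x dvd p ^ k * m" by simp
    then obtain a b where x: "x = a * b" "a dvd p ^ k" "b dvd m" using division_decomp by blast
    then obtain j where "j \<le> k" "a = p ^ j" using p divides_primepow_nat by blast
    with x show "x \<in> (\<lambda>(j, d). p ^ j * d) ` ({..k} \<times> {d. d dvd m})" by auto
  qed (auto intro: mult_dvd_mono le_imp_power_dvd)
  show ?thesis
    unfolding img [symmetric] sum.reindex[OF inj]
    by (simp add: sum_product sum.cartesian_product case_prod_unfold real_charD[OF f] real_char_power[OF f])
qed

lemma sum_char_powers:
  assumes "e \<in> {-1, 0, 1::real}"
  shows "(\<Sum>j\<le>k. e ^ j) \<ge> 0" "even k \<Longrightarrow> (\<Sum>j\<le>k. e ^ j) \<ge> 1"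
proof -
  have m: "(\<Sum>j\<le>k. (-1::real) ^ j) = (if even k then 1 else 0)" by (induction k) auto
  have z: "(\<Sum>j\<le>k. (0::real) ^ j) = 1" by (induction k) auto
  show "(\<Sum>j\<le>k. e ^ j) \<ge> 0" "even k \<Longrightarrow> (\<Sum>j\<le>k. e ^ j) \<ge> 1" using assms m z by auto
qed

lemma prime_power_split:
  fixes m :: nat assumes "m > 1"
  obtains p k m' where "prime p" "m = p ^ k * m'" "\<not> p dvd m'" "m' > 0" "m' < m" "k > 0"
proof -
  obtain p where p: "prime p" "p dvd m" using assms prime_factor_nat[of m] by auto
  obtain m' where m': "m = p ^ multiplicity p m * m'" "\<not> p dvd m'"
    using multiplicity_decompose'[of m p] p assms by (metis not_prime_unit not_one_less_zero)
  have k: "multiplicity p m > 0" using p assms by (simp add: prime_multiplicity_gt_zero_iff)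
  have "m' > 0" using m' assms by (intro Nat.gr0I) auto
  moreover have "p ^ multiplicity p m > 1" using p k prime_gt_1_nat by (intro one_less_power) auto
  ultimately have "m' < m" using m'(1) by (metis mult_less_cancel2 mult_1)
  with that p m' k \<open>m' > 0\<close> show ?thesis by blast
qed

text \<open>Splitting off one prime power at a time produces factors 1 + e + ... + e^k with e in
  {-1, 0, 1}, none of which is negative.\<close>

lemma divisor_sum_nonneg:
  assumes f: "real_char M f" shows "m > 0 \<Longrightarrow> (\<Sum>d | d dvd m. f d) \<ge> 0"
proof (induction m rule: less_induct)
  case (less m)
  show ?case
  proof (cases "m = 1")
    case True then show ?thesis by (simp add: real_charD[OF f])
  next
    case False
    with less.prems have "m > 1" by simp
    then obtain p k m' where m: "prime p" "m = p ^ k * m'" "\<not> p dvd m'" "m' > 0" "m' < m"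
      by (rule prime_power_split)
    show ?thesis unfolding m(2) divisor_sum_prime_power[OF f m(1,3,4)]
      by (intro mult_nonneg_nonneg sum_char_powers less.IH real_charD(5)[OF f] m)
  qed
qed

text \<open>The exponents in a square are even, so each of these factors is at least 1, also for e =
  -1.\<close>

lemma divisor_sum_square_ge_1:
  assumes f: "real_char M f" shows "r > 0 \<Longrightarrow> (\<Sum>d | d dvd r\<^sup>2. f d) \<ge> 1"
proof (induction r rule: less_induct)
  case (less r)
  show ?case
  proof (cases "r = 1")
    case True then show ?thesis by (simp add: real_charD[OF f])
  next
    case False
    with less.prems have "r > 1" by simp
    then obtain p k m' where m: "prime p" "r = p ^ k * m'" "\<not> p dvd m'" "m' > 0" "m' < r"
      by (rule prime_power_split)
    have r: "r\<^sup>2 = p ^ (2 * k) * m'\<^sup>2" by (simp add: m(2) power_mult_distrib power_mult [symmetric] mult.commute)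
    have nd: "\<not> p dvd m'\<^sup>2" "m'\<^sup>2 > 0" using m prime_dvd_power by auto
    have 1: "1 \<le> (\<Sum>j\<le>2 * k. f p ^ j)" by (intro sum_char_powers real_charD(5)[OF f]) simp
    have 2: "1 \<le> (\<Sum>d | d dvd m'\<^sup>2. f d)" using less.IH m by blast
    have "1 * 1 \<le> (\<Sum>j\<le>2 * k. f p ^ j) * (\<Sum>d | d dvd m'\<^sup>2. f d)"
      using 1 2 by (intro mult_mono) auto
    then show ?thesis unfolding r divisor_sum_prime_power[OF f m(1) nd] by simp
  qed
qed

section \<open>Convergence and nonvanishing of L(1, f)\<close>

lemma char_harmonic_tail:
  assumes f: "real_char M f" and b: "f b = -1" and cop: "coprime b M"
  shows "\<bar>\<Sum>k=Suc m..<n. f k / real k\<bar> \<le> 2 * real M / Suc m"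
  using abel_bound[of f M "Suc m" "\<lambda>k. 1 / real k" n] real_char_sum_bound[OF f b cop]
  by (simp add: field_simps)

text \<open>The explicit rate is recorded along with the limit because
  \<open>mertens_char_bounded\<close> replaces partial sums of varying length by
  \<open>L\<close>.\<close>

lemma char_L1:
  assumes f: "real_char M f" and b: "f b = -1" and cop: "coprime b M"
  obtains L where "(\<lambda>n. \<Sum>k=1..n. f k / real k) \<longlonglongrightarrow> L"
    and "\<And>n. \<bar>L - (\<Sum>k=1..n. f k / real k)\<bar> \<le> 2 * real M / Suc n"
proof -
  define l where "l n = (\<Sum>k=1..n. f k / real k)" for n
  have diff: "\<bar>l n - l m\<bar> \<le> 2 * real M / Suc m" if "m \<le> n" for m n
  proof -
    have "l n - l m = (\<Sum>k=Suc m..<Suc n. f k / real k)"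
      using that
    proof (induction n rule: dec_induct)
      case (step n)
      then show ?case by (simp add: l_def)
    qed simp
    then show ?thesis using char_harmonic_tail[OF f b cop, of m "Suc n"] by simp
  qed
  have lim0: "(\<lambda>n. 2 * real M / Suc n) \<longlonglongrightarrow> 0" by real_asymp
  have "Cauchy l"
  proof (rule CauchyI')
    fix e :: real assume "e > 0"
    then obtain m where m: "\<And>n. n \<ge> m \<Longrightarrow> 2 * real M / Suc n < e"
      using order_tendstoD(2)[OF lim0 \<open>e > 0\<close>] unfolding eventually_sequentially by blast
    show "\<exists>N. \<forall>m\<ge>N. \<forall>n>m. dist (l m) (l n) < e"
    proof (intro exI allI impI)
      fix i j assume "m \<le> i" "i < j"
      then show "dist (l i) (l j) < e" using diff[of i j] m[of i] by (auto simp: dist_real_def abs_minus_commute)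
    qed
  qed
  then obtain L where L: "l \<longlonglongrightarrow> L" using Cauchy_convergent_iff convergent_def by blast
  have "\<bar>L - l n\<bar> \<le> 2 * real M / Suc n" for n
  proof (rule tendsto_upperbound)
    show "(\<lambda>k. \<bar>l k - l n\<bar>) \<longlonglongrightarrow> \<bar>L - l n\<bar>" by (intro tendsto_intros L)
    show "\<forall>\<^sub>F k in sequentially. \<bar>l k - l n\<bar> \<le> 2 * real M / Suc n"
      using eventually_ge_at_top[of n] by eventually_elim (rule diff)
  qed simp
  with L that show ?thesis unfolding l_def by blast
qed

lemma summable_nat_times_power:
  fixes x :: real assumes "0 < x" "x < 1" shows "summable (\<lambda>m. real m * x ^ m)"
proof -
  have "summable (\<lambda>n. x * (of_nat (Suc n) * x ^ n))"
    using assms geometric_deriv_sums[of x] by (intro summable_mult) (auto simp: sums_iff)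
  then have "summable (\<lambda>n. real (Suc n) * x ^ Suc n)" by (simp add: mult_ac)
  then show ?thesis by (subst (asm) summable_Suc_iff)
qed

text \<open>Only finitely many Lambert terms are expanded, so no double series has to be rearranged.
  Up to \<open>N\<close> the coefficients are full divisor sums: nonnegative, and at least 1 at
  squares. Beyond \<open>N\<close> the coefficient of \<open>x ^ m\<close> has absolute value at
  most \<open>m\<close>, which accounts for the subtracted tail.\<close>

lemma truncated_lambert_ge:
  fixes x :: real
  assumes f: "real_char M f" and x: "0 < x" "x < 1" and K: "K\<^sup>2 \<le> N"
  shows "(\<Sum>n=1..N. f n * (x ^ n / (1 - x ^ n))) \<ge>
           (\<Sum>k=1..K. x ^ k\<^sup>2) - (\<Sum>m. real (m + Suc N) * x ^ (m + Suc N))"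
proof -
  define c where "c m = (\<Sum>n\<in>{n\<in>{1..N}. n dvd m}. f n)" for m
  define g where "g m = (if m > 0 then c m * x ^ m else 0)" for m
  have "(\<lambda>m. \<Sum>n=1..N. f n * (if n dvd m \<and> m > 0 then x ^ m else 0)) sums
          (\<Sum>n=1..N. f n * (x ^ n / (1 - x ^ n)))"
    by (intro sums_sum sums_mult divisor_sums x) auto
  also have "(\<lambda>m. \<Sum>n=1..N. f n * (if n dvd m \<and> m > 0 then x ^ m else 0)) = g"
  proof
    fix m show "(\<Sum>n=1..N. f n * (if n dvd m \<and> m > 0 then x ^ m else 0)) = g m"
      unfolding g_def c_def sum_distrib_right sum.inter_filter[OF finite_atLeastAtMost]
      by (auto intro!: sum.cong)
  qed
  finally have sums: "g sums (\<Sum>n=1..N. f n * (x ^ n / (1 - x ^ n)))" .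
  then have eq: "(\<Sum>n=1..N. f n * (x ^ n / (1 - x ^ n))) = (\<Sum>m. g (m + Suc N)) + (\<Sum>m<Suc N. g m)"
    using suminf_split_initial_segment[of g "Suc N"] by (simp add: sums_iff)
  have c: "c m = (\<Sum>d | d dvd m. f d)" if "m \<in> {1..N}" for m
    unfolding c_def using that by (intro sum.cong) (auto intro: Nat.gr0I dest: dvd_imp_le)
  have "(\<Sum>k=1..K. x ^ k\<^sup>2) \<le> (\<Sum>k=1..K. g (k\<^sup>2))"
  proof (rule sum_mono)
    fix k assume k: "k \<in> {1..K}"
    then have "k\<^sup>2 \<le> K\<^sup>2" by (intro power_mono) auto
    then have "k\<^sup>2 \<le> N" using K by (rule le_trans)
    then have "k\<^sup>2 \<in> {1..N}" using k by (auto simp: Suc_le_eq)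
    then have "c (k\<^sup>2) \<ge> 1" using divisor_sum_square_ge_1[OF f, of k] c[of "k\<^sup>2"] k K by auto
    then show "x ^ k\<^sup>2 \<le> g (k\<^sup>2)" using k x mult_right_mono[of 1 "c (k\<^sup>2)" "x ^ k\<^sup>2"] by (auto simp: g_def)
  qed
  also have "\<dots> = (\<Sum>m\<in>(\<lambda>k. k\<^sup>2) ` {1..K}. g m)"
    by (subst sum.reindex) (auto simp: inj_on_def)
  also have "\<dots> \<le> (\<Sum>m<Suc N. g m)"
  proof (rule sum_mono2)
    have "k\<^sup>2 \<le> N" if "k \<le> K" for k using power_mono[OF that, of 2] K by linarith
    then show "(\<lambda>k. k\<^sup>2) ` {1..K} \<subseteq> {..<Suc N}" by (auto simp: less_Suc_eq_le)
    fix m assume "m \<in> {..<Suc N} - (\<lambda>k. k\<^sup>2) ` {1..K}"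
    then show "0 \<le> g m" using c[of m] divisor_sum_nonneg[OF f, of m] x by (auto simp: g_def)
  qed auto
  finally have 1: "(\<Sum>k=1..K. x ^ k\<^sup>2) \<le> (\<Sum>m<Suc N. g m)" .
  note sm = summable_nat_times_power[OF x]
  have cb: "\<bar>c m\<bar> \<le> m" if "m > 0" for m
  proof -
    have "\<bar>c m\<bar> \<le> (\<Sum>n\<in>{n\<in>{1..N}. n dvd m}. 1)"
      unfolding c_def by (intro order.trans[OF sum_abs] sum_mono real_charD(6)[OF f])
    also have "\<dots> = real (card {n\<in>{1..N}. n dvd m})" by simp
    also have "card {n\<in>{1..N}. n dvd m} \<le> card {1..m}"
      using that by (intro card_mono) (auto dest: dvd_imp_le)
    finally show ?thesis by simp
  qed
  have "- (\<Sum>m. real (m + Suc N) * x ^ (m + Suc N)) = (\<Sum>m. - (real (m + Suc N) * x ^ (m + Suc N)))"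
    by (rule suminf_minus [symmetric]) (rule summable_ignore_initial_segment[OF sm])
  also have "\<dots> \<le> (\<Sum>m. g (m + Suc N))"
  proof (rule suminf_le)
    show "- (real (m + Suc N) * x ^ (m + Suc N)) \<le> g (m + Suc N)" for m
    proof -
      have "\<bar>c (m + Suc N) * x ^ (m + Suc N)\<bar> \<le> real (m + Suc N) * x ^ (m + Suc N)"
        unfolding abs_mult using cb[of "m + Suc N"] x by (intro mult_mono) auto
      then show ?thesis by (simp add: g_def abs_le_iff)
    qed
    show "summable (\<lambda>m. - (real (m + Suc N) * x ^ (m + Suc N)))"
      using summable_ignore_initial_segment[OF sm] by (rule summable_minus)
    show "summable (\<lambda>m. g (m + Suc N))"
      using sums by (intro summable_ignore_initial_segment) (simp add: sums_iff)
  qed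
  finally show ?thesis using 1 eq by linarith
qed

text \<open>At a fixed \<open>x\<close> close to 1 the truncated Lambert sum is bounded twice. Abel
  summation against \<open>bb\<close>, with \<open>bb 1 = 1\<close>, gives at most
  \<open>2 * M\<close> plus a multiple of the partial sums of L(1, f), which would tend to 0. The
  first \<open>K\<close> squares give at least \<open>K / 2\<close> up to a vanishing tail.\<close>

lemma char_L1_nonzero:
  assumes f: "real_char M f" and b: "f b = -1" and cop: "coprime b M"
  shows "\<not> (\<lambda>n. \<Sum>k=1..n. f k / real k) \<longlonglongrightarrow> 0"
proof
  assume lim: "(\<lambda>n. \<Sum>k=1..n. f k / real k) \<longlonglongrightarrow> 0"
  \<comment> \<open>Chosen so that \<open>K / 2\<close> exceeds \<open>2 * M\<close>. The
    \<open>x\<close> below is the root of 1/2 of order \<open>K\<^sup>2\<close>, so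
    \<open>x ^ k\<^sup>2\<close> is at least 1/2 for all \<open>k \<le> K\<close>.\<close>
  define K where "K = 4 * M + 1"
  have Kp: "K > 0" by (simp add: K_def)
  obtain x :: real where x: "0 < x" "x < 1" "x ^ K\<^sup>2 \<ge> 1 / 2"
  proof
    show "0 < root (K\<^sup>2) (1/2)" "root (K\<^sup>2) (1/2) < 1" "root (K\<^sup>2) (1/2) ^ K\<^sup>2 \<ge> 1/2"
      using Kp by (auto simp: real_root_lt_1_iff)
  qed
  define S where "S N = (\<Sum>n=1..N. f n * (x ^ n / (1 - x ^ n)))" for N
  define tl where "tl N = (\<Sum>m. real (m + Suc N) * x ^ (m + Suc N))" for N
  define bb where "bb n = 1 / (real n * (1 - x)) - x ^ n / (1 - x ^ n)" for n
  note sm = summable_nat_times_power[OF x(1,2)]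
  have up: "S N \<le> 2 * M + (\<Sum>k=1..N. f k / real k) / (1 - x)" for N
  proof -
    have "\<bar>\<Sum>n=1..<Suc N. f n * bb n\<bar> \<le> 2 * real M * bb 1"
      unfolding bb_def
      using monsky_decreasing[OF x(1,2)] real_char_sum_bound[OF f b cop] by (intro abel_bound) auto
    also have "bb 1 = 1" using x by (simp add: bb_def field_simps)
    finally have "\<bar>\<Sum>n=1..N. f n * bb n\<bar> \<le> 2 * real M" by (simp add: atLeastLessThanSuc_atLeastAtMost)
    moreover have "(\<Sum>n=1..N. f n * bb n) = (\<Sum>k=1..N. f k / real k) / (1 - x) - S N"
      unfolding bb_def S_def by (simp add: sum_subtractf sum_divide_distrib right_diff_distrib)
    ultimately show ?thesis by linarith
  qed
  have "(\<Sum>k=1..K. (1/2::real)) \<le> (\<Sum>k=1..K. x ^ k\<^sup>2)"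
  proof (rule sum_mono)
    fix k assume "k \<in> {1..K}"
    then have "k\<^sup>2 \<le> K\<^sup>2" by (intro power_mono) auto
    then have "x ^ K\<^sup>2 \<le> x ^ k\<^sup>2" using x by (intro power_decreasing) auto
    then show "1/2 \<le> x ^ k\<^sup>2" using x by linarith
  qed
  then have half: "real K / 2 \<le> (\<Sum>k=1..K. x ^ k\<^sup>2)" by simp
  have "real K / 2 \<le> 2 * M"
  proof (rule tendsto_le[OF sequentially_bot])
    have "tl \<longlonglongrightarrow> 0" unfolding tl_def using suminf_exist_split2[OF sm] LIMSEQ_Suc by blast
    then show "(\<lambda>N. real K / 2 - tl N) \<longlonglongrightarrow> real K / 2" by (auto intro!: tendsto_eq_intros)
    show "(\<lambda>N. 2 * M + (\<Sum>k=1..N. f k / real k) / (1 - x)) \<longlonglongrightarrow> 2 * M"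
      using x by (auto intro!: tendsto_eq_intros lim[unfolded One_nat_def])
    show "\<forall>\<^sub>F N in sequentially. real K / 2 - tl N \<le> 2 * M + (\<Sum>k=1..N. f k / real k) / (1 - x)"
      using eventually_ge_at_top[of "K\<^sup>2"]
    proof eventually_elim
      case (elim N)
      from truncated_lambert_ge[OF f x(1,2) elim] half up[of N]
      show ?case unfolding S_def tl_def by linarith
    qed
  qed
  then show False by (simp add: K_def)
qed

section \<open>Elementary estimates for the von Mangoldt function\<close>

lemma sum_over_divisors:
  fixes h :: "nat \<Rightarrow> nat \<Rightarrow> real"
  shows "(\<Sum>n=1..N. \<Sum>d | d dvd n. h d n) = (\<Sum>d=1..N. \<Sum>k=1..N div d. h d (d * k))"
proof -
  have le: "b \<le> N" if "b * k \<le> N" "k > 0" for b k :: nat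
    using that by (cases k) auto
  have "(\<Sum>n=1..N. \<Sum>d | d dvd n. h d n) = (\<Sum>(n, d)\<in>(SIGMA n:{1..N}. {d. d dvd n}). h d n)"
    by (subst sum.Sigma) (auto intro!: finite_divisors_nat)
  also have "\<dots> = (\<Sum>(d, k)\<in>(SIGMA d:{1..N}. {1..N div d}). h d (d * k))"
    by (rule sum.reindex_bij_witness[where i = "\<lambda>(d, k). (d * k, d)" and j = "\<lambda>(n, d). (d, n div d)"])
       (auto simp: Suc_le_eq less_eq_div_iff_mult_less_eq mult.commute div_le_mono
             intro: Nat.gr0I le dest: dvd_imp_le elim!: dvdE)
  also have "\<dots> = (\<Sum>d=1..N. \<Sum>k=1..N div d. h d (d * k))"
    by (subst sum.Sigma) auto
  finally show ?thesis .
qed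

lemma sum_ln_mangoldt: "(\<Sum>n=1..N. ln (real n)) = (\<Sum>d=1..N. mangoldt d * real (N div d))"
proof -
  have "(\<Sum>n=1..N. ln (real n)) = (\<Sum>n=1..N. \<Sum>d | d dvd n. mangoldt d)"
    by (intro sum.cong) (auto simp: mangoldt_sum)
  also have "\<dots> = (\<Sum>d=1..N. \<Sum>k=1..N div d. mangoldt d)" by (rule sum_over_divisors)
  finally show ?thesis by (simp add: mult.commute)
qed

lemma ln_Suc_le: "n \<ge> 1 \<Longrightarrow> ln (real (Suc n)) \<le> ln (real n) + 1 / real n"
proof -
  assume "n \<ge> 1"
  then have "ln (real (Suc n)) - ln (real n) = ln (real (Suc n) / real n)" by (simp add: ln_divide_pos)
  also have "real (Suc n) / real n = 1 + 1 / real n" using \<open>n \<ge> 1\<close> by (simp add: field_simps)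
  also have "ln (1 + 1 / real n) \<le> 1 / real n" by (rule ln_add_one_self_le_self) simp
  finally show ?thesis by simp
qed

text \<open>A weak Stirling bound for the sum of logarithms, which by \<open>sum_ln_mangoldt\<close>
  is the sum of \<open>mangoldt d * (N div d)\<close>; dropping the rounding only increases the
  latter.\<close>

lemma mangoldt_log_sum_lower:
  assumes "N \<ge> 1" shows "(\<Sum>d=1..N. mangoldt d / real d) \<ge> ln N - 1"
proof -
  have "real N * ln N - N \<le> (\<Sum>n=1..N. ln (real n))"
    using assms
  proof (induction N rule: dec_induct)
    case base
    then show ?case by simp
  next
    case (step N)
    have "real N * (ln (Suc N) - ln N) \<le> 1"
      using step ln_Suc_le[of N] by (simp add: field_simps)

    then show ?case using step by (simp add: algebra_simps)
  qed
  also have "\<dots> = (\<Sum>d=1..N. mangoldt d * real (N div d))" by (rule sum_ln_mangoldt)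
  also have "\<dots> \<le> (\<Sum>d=1..N. mangoldt d * (real N / real d))"
    by (intro sum_mono mult_left_mono mangoldt_nonneg of_nat_div_le_of_nat)
  also have "\<dots> = real N * (\<Sum>d=1..N. mangoldt d / real d)" by (simp add: sum_distrib_left mult_ac)
  finally have "real N * (ln N - 1) \<le> real N * (\<Sum>d=1..N. mangoldt d / real d)" by (simp add: algebra_simps)
  then show ?thesis using assms by simp
qed

text \<open>Chebyshev's argument: the logarithm of the central binomial coefficient is the sum of
  \<open>mangoldt d\<close> times \<open>2 * N div d - 2 * (N div d)\<close>. This weight is never
  negative and equals 1 for \<open>N < d \<le> 2 * N\<close>.\<close>

lemma mangoldt_sum_double: "(\<Sum>d\<in>{N<..2 * N}. mangoldt d :: real) \<le> 2 * real N * ln 2"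
proof -
  have fact: "(\<Sum>n=1..m. ln (real n)) = ln (fact m)" for m
    by (induction m) (auto simp: ln_mult)
  have split: "2 * N div d \<ge> 2 * (N div d)" for d
  proof (cases "d = 0")
    case False
    have "2 * (N div d) * d \<le> 2 * N" using div_times_less_eq_dividend[of N d] by (simp add: mult.assoc)
    then show ?thesis using False by (simp add: less_eq_div_iff_mult_less_eq)
  qed simp
  have "(\<Sum>d\<in>{N<..2 * N}. mangoldt d :: real) \<le>
          (\<Sum>d=1..2 * N. mangoldt d * (real (2 * N div d) - 2 * real (N div d)))"
  proof -
    have "(\<Sum>d\<in>{N<..2 * N}. mangoldt d :: real) =
            (\<Sum>d\<in>{N<..2 * N}. mangoldt d * (real (2 * N div d) - 2 * real (N div d)))"
    proof (rule sum.cong)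
      fix d assume d: "d \<in> {N<..2 * N}"
      then have "2 * N div d = 1" "N div d = 0" by (auto simp: div_nat_eqI)
      then show "mangoldt d = mangoldt d * (real (2 * N div d) - 2 * real (N div d))" by simp
    qed simp
    also have "\<dots> \<le> (\<Sum>d=1..2 * N. mangoldt d * (real (2 * N div d) - 2 * real (N div d)))"
    proof (rule sum_mono2)
      fix d show "0 \<le> mangoldt d * (real (2 * N div d) - 2 * real (N div d))"
        using split[of d] by (intro mult_nonneg_nonneg mangoldt_nonneg) linarith
    qed auto
    finally show ?thesis .
  qed
  also have "\<dots> = ln (fact (2 * N)) - 2 * (\<Sum>d=1..2 * N. mangoldt d * real (N div d))"
    unfolding fact [symmetric] sum_ln_mangoldt
    by (simp add: sum_subtractf right_diff_distrib sum_distrib_left mult_ac)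
  also have "(\<Sum>d=1..2 * N. mangoldt d * real (N div d)) = (\<Sum>d=1..N. mangoldt d * real (N div d))"
    by (rule sum.mono_neutral_right) auto
  also have "\<dots> = ln (fact N)" by (simp only: sum_ln_mangoldt [symmetric] fact)
  also have "ln (fact (2 * N)) - 2 * ln (fact N) = ln (real (2 * N choose N))"
  proof -
    have "fact N * fact N * (2 * N choose N) = (fact (2 * N) :: nat)"
      using binomial_fact_lemma[of N "2 * N"] by (simp add: mult_2)
    then have "real (fact (2 * N)) = real (fact N * fact N * (2 * N choose N))" by simp
    then have "(fact (2 * N) :: real) = fact N * fact N * (2 * N choose N)" by simp
    then show ?thesis by (simp add: ln_mult)
  qed
  also have "\<dots> \<le> ln (2 ^ (2 * N))"
  proof -
    have "2 * N choose N \<le> 2 ^ (2 * N)" by (rule binomial_le_pow2)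
    then have "real (2 * N choose N) \<le> real (2 ^ (2 * N))" by (rule of_nat_mono)
    moreover have "real (2 * N choose N) > 0" by (simp add: zero_less_binomial)
    ultimately show ?thesis by (simp del: ln_realpow)
  qed
  also have "\<dots> = 2 * real N * ln 2" by (simp add: ln_realpow)
  finally show ?thesis .
qed

lemma chebyshev_upper: "(\<Sum>d=1..N. mangoldt d :: real) \<le> 8 * real N"
proof (induction N rule: less_induct)
  case (less N)
  show ?case
  proof (cases "N \<le> 1")
    case True
    then have "N = 0 \<or> N = 1" by auto
    then show ?thesis by auto
  next
    case False
    \<comment> \<open>Half of \<open>N\<close>, rounded up. The constant 8 lets the induction close:
      \<open>8 * k + 2 * k \<le> 8 * N\<close> holds as soon as \<open>N \<ge> 2\<close>.\<close>
    define k where "k = (N + 1) div 2"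
    have k: "k < N" "N \<le> 2 * k" "2 * k \<le> N + 1" using False by (auto simp: k_def)
    have "(\<Sum>d=1..N. mangoldt d :: real) \<le> (\<Sum>d\<in>{1..k} \<union> {k<..2 * k}. mangoldt d)"
      using k by (intro sum_mono2) (auto intro: mangoldt_nonneg)
    also have "\<dots> = (\<Sum>d=1..k. mangoldt d) + (\<Sum>d\<in>{k<..2 * k}. mangoldt d)"
      by (rule sum.union_disjoint) auto
    also have "\<dots> \<le> 8 * real k + 2 * real k * ln 2"
      using less.IH[OF k(1)] mangoldt_sum_double[of k] by linarith
    also have "\<dots> \<le> 8 * real k + 2 * real k * 1"
      using ln_2_less_1 by (intro add_left_mono mult_left_mono) auto
    also have "\<dots> \<le> 8 * real N"
    proof -
      have "10 * k \<le> 8 * N" using k False by linarith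
      then show ?thesis by linarith
    qed
    finally show ?thesis .
  qed
qed

text \<open>Write \<open>ln n\<close> as a divisor sum of \<open>mangoldt\<close>. The sum of
  \<open>f n * ln n / n\<close>, bounded by Abel summation, becomes the sum of
  \<open>mangoldt d * f d / d\<close> times a partial sum of L(1, f) of length
  \<open>N div d\<close>. Replacing these partial sums by \<open>L\<close> costs a bounded amount by
  \<open>chebyshev_upper\<close>, and \<open>L\<close> is nonzero, so one can divide by it.\<close>

lemma mertens_char_bounded:
  assumes f: "real_char M f" and b: "f b = -1" and cop: "coprime b M"
  obtains C where "\<And>N. \<bar>\<Sum>d=1..N. mangoldt d * f d / real d\<bar> \<le> C"
proof -
  obtain L where L: "(\<lambda>n. \<Sum>k=1..n. f k / real k) \<longlonglongrightarrow> L"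
    and tail: "\<And>n. \<bar>L - (\<Sum>k=1..n. f k / real k)\<bar> \<le> 2 * real M / Suc n"
    using char_L1[OF assms] by blast
  have L0: "L \<noteq> 0" using char_L1_nonzero[OF assms] L by auto
  define l where "l n = (\<Sum>k=1..n. f k / real k)" for n
  define A where "A N = (\<Sum>d=1..N. mangoldt d * f d / real d)" for N
  \<comment> \<open>The function ln n / n decreases only from n = 3 on; the term for n = 1 vanishes
    and the one for n = 2 is estimated by \<open>ln 2\<close>.\<close>
  define C0 where "C0 = ln 2 + 2 * real M * (ln 3 / 3)"
  have U: "\<bar>\<Sum>n=1..N. f n * (ln n / n)\<bar> \<le> C0" for N
  proof -
    have dec: "ln (real (Suc i)) / real (Suc i) \<le> ln (real i) / real i" if "i \<ge> 3" for i
    proof -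
      have e: "exp 1 \<le> real i" using that exp_le by linarith
      have "ln (real (Suc i)) \<le> ln i + 1 / i"
        using that ln_Suc_le[of i] by simp
      moreover have "1 \<le> ln (real i)" using e that by (subst ln_ge_iff) auto
      ultimately have "real i * ln (real (Suc i)) \<le> real (Suc i) * ln (real i)"
        using that by (simp add: field_simps)
      then show ?thesis using that by (simp add: field_simps)
    qed
    have 1: "\<bar>\<Sum>n=3..<Suc N. f n * (ln n / n)\<bar> \<le> 2 * real M * (ln (real 3) / real 3)"
      by (rule abel_bound) (use real_char_sum_bound[OF assms] dec in auto)
    have 2: "(\<Sum>n=1..N. f n * (ln n / n)) = (\<Sum>n=3..<Suc N. f n * (ln n / n)) + (\<Sum>n\<in>{1..N} \<inter> {2}. f n * (ln n / n))"
    proof -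
      have "(\<Sum>n=1..N. f n * (ln n / n)) = (\<Sum>n\<in>{3..<Suc N} \<union> ({1..N} \<inter> {2}). f n * (ln n / n))"
      proof (rule sum.mono_neutral_right)
        show "\<forall>i\<in>{1..N} - ({3..<Suc N} \<union> {1..N} \<inter> {2}). f i * (ln (real i) / real i) = 0"
        proof
          fix i assume "i \<in> {1..N} - ({3..<Suc N} \<union> {1..N} \<inter> {2})"
          then have "i = 1" by auto
          then show "f i * (ln (real i) / real i) = 0" by simp
        qed
      qed auto
      also have "\<dots> = (\<Sum>n=3..<Suc N. f n * (ln n / n)) + (\<Sum>n\<in>{1..N} \<inter> {2}. f n * (ln n / n))"
        by (rule sum.union_disjoint) auto
      finally show ?thesis .
    qed
    have 3: "\<bar>\<Sum>n\<in>{1..N} \<inter> {2}. f n * (ln n / n)\<bar> \<le> ln 2"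
    proof (cases "2 \<le> N")
      case True
      then have "{1..N} \<inter> {2} = {2::nat}" by auto
      moreover have "\<bar>f 2 * (ln 2 / 2)\<bar> \<le> 1 * (ln 2 / 2)"
        unfolding abs_mult using real_charD(6)[OF f, of 2] by (intro mult_mono) auto
      ultimately show ?thesis by simp
    next
      case False
      then have "{1..N} \<inter> {2} = ({} :: nat set)" by auto
      then show ?thesis by simp
    qed
    show ?thesis using 1 2 3 unfolding C0_def by simp
  qed
  have "\<bar>A N\<bar> \<le> (C0 + 16 * M) / \<bar>L\<bar>" for N
  proof (cases "N = 0")
    case False
    have "(\<Sum>n=1..N. f n * (ln n / n)) = (\<Sum>n=1..N. \<Sum>d | d dvd n. mangoldt d * f n / n)"
    proof (rule sum.cong)
      fix n assume "n \<in> {1..N}"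
      then have "ln (real n) = (\<Sum>d | d dvd n. mangoldt d)" by (subst mangoldt_sum) auto
      then show "f n * (ln n / n) = (\<Sum>d | d dvd n. mangoldt d * f n / n)"
        by (simp add: sum_distrib_left sum_divide_distrib mult.commute)
    qed simp
    also have "\<dots> = (\<Sum>d=1..N. \<Sum>k=1..N div d. mangoldt d * f (d * k) / real (d * k))"
      by (rule sum_over_divisors)
    also have "\<dots> = (\<Sum>d=1..N. mangoldt d * f d / d * l (N div d))"
      unfolding l_def by (simp add: sum_distrib_left real_charD(3)[OF f] mult.assoc)
    finally have 1: "(\<Sum>n=1..N. f n * (ln n / n)) = (\<Sum>d=1..N. mangoldt d * f d / d * l (N div d))" .
    have "(\<Sum>d=1..N. mangoldt d * f d / d * (L - l (N div d))) =
            (\<Sum>d=1..N. mangoldt d * f d / d * L) - (\<Sum>d=1..N. mangoldt d * f d / d * l (N div d))"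
      by (simp only: right_diff_distrib sum_subtractf)
    also have "(\<Sum>d=1..N. mangoldt d * f d / d * L) = L * A N"
      unfolding A_def by (simp only: sum_distrib_left mult.commute)
    finally have eq: "L * A N = (\<Sum>n=1..N. f n * (ln n / n)) + (\<Sum>d=1..N. mangoldt d * f d / d * (L - l (N div d)))"
      using 1 by simp
    have "\<bar>\<Sum>d=1..N. mangoldt d * f d / d * (L - l (N div d))\<bar> \<le> (\<Sum>d=1..N. \<bar>mangoldt d * f d / d * (L - l (N div d))\<bar>)"
      by (rule sum_abs)
    also have "\<dots> \<le> (\<Sum>d=1..N. mangoldt d * (2 * M / N))"
    proof (rule sum_mono)
      fix d assume d: "d \<in> {1..N}"
      \<comment> \<open>This turns the tail bound at \<open>N div d\<close> into a multiple of
        \<open>d / N\<close>, and the factor \<open>d\<close> cancels the denominator of the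
        summand.\<close>
      have "N \<le> d * Suc (N div d)" using dividend_less_times_div[of d N] d by simp
      then have "real N \<le> real (d * Suc (N div d))" by (rule of_nat_mono)
      then have dN: "real N \<le> real d * real (Suc (N div d))" by (simp only: of_nat_mult)
      have "\<bar>L - l (N div d)\<bar> \<le> 2 * real M / Suc (N div d)" unfolding l_def by (rule tail)
      also have "\<dots> \<le> 2 * M * d / N"
        using dN False mult_left_mono[OF dN, of "2 * real M"] by (simp add: field_simps)
      finally have 1: "\<bar>L - l (N div d)\<bar> \<le> 2 * M * d / N" .
      have "\<bar>mangoldt d * f d / d * (L - l (N div d))\<bar> = mangoldt d / d * (\<bar>f d\<bar> * \<bar>L - l (N div d)\<bar>)"
        by (simp add: abs_mult)
      also have "\<dots> \<le> mangoldt d / d * (1 * (2 * M * d / N))"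
        using 1 real_charD(6)[OF f, of d] mangoldt_nonneg[of d] by (intro mult_left_mono mult_mono) auto
      also have "\<dots> = mangoldt d * (2 * M / N)" using d by simp
      finally show "\<bar>mangoldt d * f d / d * (L - l (N div d))\<bar> \<le> mangoldt d * (2 * M / N)" .
    qed
    also have "\<dots> = (\<Sum>d=1..N. mangoldt d) * (2 * M / N)" by (simp only: sum_distrib_right)
    also have "\<dots> \<le> 8 * N * (2 * M / N)" using chebyshev_upper[of N] by (intro mult_right_mono) auto
    also have "\<dots> = 16 * M" using False by simp
    finally have "\<bar>L * A N\<bar> \<le> C0 + 16 * M" using eq U[of N] by linarith
    then show ?thesis using L0 by (simp add: abs_mult field_simps)
  next
    case True
    have "0 \<le> C0" unfolding C0_def by simp
    then show ?thesis using True by (simp add: A_def)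
  qed
  then show ?thesis using that unfolding A_def by blast
qed

text \<open>Only powers of exponent at least 2 contribute. For a prime p the geometric series gives
  at most 2 ln p / p^2, and ln p is at most 2 sqrt p, so the total is dominated by a convergent
  series with exponent 3/2.\<close>

lemma nonprime_mangoldt_bounded:
  obtains C where "\<And>N. (\<Sum>d\<in>{d\<in>{1..N}. \<not> prime d}. mangoldt d / real d) \<le> C"
proof -
  have sm: "summable (\<lambda>p. 4 * (real p powr (-3/2)))"
    by (intro summable_mult) (simp add: summable_real_powr_iff)
  have "(\<Sum>d\<in>{d\<in>{1..N}. \<not> prime d}. mangoldt d / real d) \<le> (\<Sum>p. 4 * (real p powr (-3/2)))" for N
  proof -
    define P where "P = {p\<in>{..N}. prime p} \<times> {2..N}"
    define F where "F d = (mangoldt d / real d :: real)" for d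
    have Fnn: "F d \<ge> 0" for d unfolding F_def by (intro divide_nonneg_nonneg mangoldt_nonneg) simp
    have finP: "finite P" by (simp add: P_def)
    have inner: "(\<Sum>k=2..N. F (p ^ k)) \<le> 4 * (real p powr (-3/2))" if "prime p" for p
    proof -
      have p2: "p \<ge> 2" using that by (rule prime_ge_2_nat)
      define x where "x = 1 / real p"
      have x: "0 < x" "x \<le> 1/2" using p2 by (auto simp: x_def field_simps)
      have sum_x: "(\<Sum>k=2..N. x ^ k) \<le> 2 * x\<^sup>2"
      proof (cases "N \<ge> 1")
        case True
        then have "(\<Sum>k=2..N. x ^ k) \<le> 2 * x\<^sup>2 - 2 * x ^ Suc N"
        proof (induction N rule: dec_induct)
          case (step N)
          then have "(\<Sum>k=2..Suc N. x ^ k) \<le> 2 * x\<^sup>2 - 2 * x ^ Suc N + x ^ Suc N" by simp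
          moreover have "2 * x ^ Suc (Suc N) \<le> x ^ Suc N"
            using x mult_right_mono[of "2 * x" 1 "x ^ Suc N"] by simp
          ultimately show ?case by linarith
        qed (simp add: power2_eq_square)
        moreover have "x ^ Suc N \<ge> 0" using x by simp
        ultimately show ?thesis by linarith
      qed (auto simp: not_le)
      have ln_p: "ln (real p) \<le> 2 * sqrt p"
        using ln_bound[of "sqrt p"] p2 by (simp add: ln_sqrt)
      have "(\<Sum>k=2..N. F (p ^ k)) = ln p * (\<Sum>k=2..N. x ^ k)"
        using that by (simp add: F_def mangoldt_primepow x_def sum_distrib_left power_divide)
      also have "\<dots> \<le> 2 * sqrt p * (2 * x\<^sup>2)"
        using x by (intro mult_mono sum_x ln_p sum_nonneg) auto
      also have "\<dots> = 4 * (real p powr (-3/2))"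
      proof -
        have "real p powr (-3/2) = real p powr (1/2) * real p powr (-2)" by (simp flip: powr_add)
        then show ?thesis using p2
          by (simp add: x_def powr_half_sqrt powr_minus powr_numeral divide_simps)
      qed
      finally show ?thesis .
    qed
    have "(\<Sum>d\<in>{d\<in>{1..N}. \<not> prime d}. F d) = (\<Sum>d\<in>{d\<in>{1..N}. \<not> prime d \<and> primepow d}. F d)"
      by (rule sum.mono_neutral_right) (auto simp: F_def mangoldt_def)
    also have "\<dots> \<le> (\<Sum>d\<in>(\<lambda>(p, k). p ^ k) ` P. F d)"
      proof (rule sum_mono2)
        show "{d\<in>{1..N}. \<not> prime d \<and> primepow d} \<subseteq> (\<lambda>(p, k). p ^ k) ` P"
        proof
          fix d assume d: "d \<in> {d\<in>{1..N}. \<not> prime d \<and> primepow d}"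
          then obtain p k where pk: "prime p" "k > 0" "d = p ^ k" by (auto simp: primepow_def)
          have "k \<noteq> 1" using pk d by auto
          moreover have "p ^ 1 \<le> p ^ k" using pk prime_ge_1_nat[of p] by (intro power_increasing) auto
          moreover have "k < p ^ k" using pk prime_gt_1_nat[of p] by (intro power_gt_expt) auto
          ultimately have "(p, k) \<in> P" using pk d by (auto simp: P_def)
          then show "d \<in> (\<lambda>(p, k). p ^ k) ` P" using pk by force
        qed
      qed (use finP Fnn in auto)
    also have "\<dots> \<le> (\<Sum>(p, k)\<in>P. F (p ^ k))"
      using sum_image_le[OF finP, of F "\<lambda>(p, k). p ^ k"] Fnn by (simp add: case_prod_unfold o_def)
    also have "\<dots> = (\<Sum>p\<in>{p\<in>{..N}. prime p}. \<Sum>k=2..N. F (p ^ k))"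
      unfolding P_def by (rule sum.cartesian_product [symmetric])
    also have "\<dots> \<le> (\<Sum>p\<in>{p\<in>{..N}. prime p}. 4 * (real p powr (-3/2)))"
      by (intro sum_mono inner) auto
    also have "\<dots> \<le> (\<Sum>p. 4 * (real p powr (-3/2)))"
      by (rule sum_le_suminf[OF sm]) auto
    finally show ?thesis unfolding F_def .
  qed
  then show ?thesis using that by blast
qed

text \<open>The weight \<open>w d\<close>, a product of the factors \<open>e i * f i d + 1\<close>,
  detects the wanted primes. Expanded over subsets of \<open>S\<close>, the empty set contributes at
  least \<open>ln N - 1\<close>. Every other subset contributes a bounded amount, because by
  \<open>indep\<close> its product character takes the value -1 at some argument coprime to its
  modulus. Without a wanted prime, \<open>w\<close> vanishes at all primes outside the moduli and
  the weighted sum would be bounded.\<close>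

theorem exists_prime_real_chars:
  fixes S :: "'i set"
  assumes S: "finite S"
    and f: "\<And>i. i \<in> S \<Longrightarrow> real_char (M i) (f i)"
    and e: "\<And>i. i \<in> S \<Longrightarrow> e i \<in> {-1, 1::real}"
    and indep: "\<And>T. T \<subseteq> S \<Longrightarrow> T \<noteq> {} \<Longrightarrow> \<exists>b. coprime b (\<Prod>i\<in>T. M i) \<and> (\<Prod>i\<in>T. f i b) = -1"
  shows "\<exists>q. prime q \<and> (\<forall>i\<in>S. f i q = e i)"
proof (rule ccontr)
  assume "\<nexists>q. prime q \<and> (\<forall>i\<in>S. f i q = e i)"
  then have none: "\<exists>i\<in>S. f i q \<noteq> e i" if "prime q" for q using that by blast
  define w where "w d = (\<Prod>i\<in>S. e i * f i d + 1)" for d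
  have exp: "w d = (\<Sum>T\<in>Pow S. (\<Prod>i\<in>T. e i) * (\<Prod>i\<in>T. f i d))" for d
    unfolding w_def prod_add[OF S] by (simp add: prod.distrib)
  define A where "A T N = (\<Sum>d=1..N. mangoldt d * (\<Prod>i\<in>T. f i d) / real d)" for T N
  have "\<exists>C. \<forall>N. \<bar>A T N\<bar> \<le> C" if T: "T \<subseteq> S" "T \<noteq> {}" for T
  proof -
    obtain b where b: "coprime b (\<Prod>i\<in>T. M i)" "(\<Prod>i\<in>T. f i b) = -1" using indep[OF T] by blast
    have "real_char (\<Prod>i\<in>T. M i) (\<lambda>n. \<Prod>i\<in>T. f i n)"
      using T S f by (intro real_char_prod) (auto intro: finite_subset)
    from mertens_char_bounded[OF this b(2,1)] show ?thesis unfolding A_def by blast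
  qed
  then obtain C where C: "\<And>T N. T \<subseteq> S \<Longrightarrow> T \<noteq> {} \<Longrightarrow> \<bar>A T N\<bar> \<le> C T" by metis
  have abs_e: "\<bar>\<Prod>i\<in>T. e i\<bar> = 1" if "T \<subseteq> S" for T
    unfolding abs_prod using that e by (intro prod.neutral) fastforce
  define W where "W N = (\<Sum>d=1..N. mangoldt d * w d / real d)" for N
  have lower: "W N \<ge> ln N - 1 - (\<Sum>T\<in>Pow S - {{}}. C T)" if "N \<ge> 1" for N
  proof -
    have "W N = (\<Sum>d=1..N. \<Sum>T\<in>Pow S. (\<Prod>i\<in>T. e i) * (mangoldt d * (\<Prod>i\<in>T. f i d) / real d))"
      unfolding W_def exp by (simp add: sum_distrib_left sum_divide_distrib mult_ac)
    also have "\<dots> = (\<Sum>T\<in>Pow S. (\<Prod>i\<in>T. e i) * A T N)"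
      unfolding A_def by (subst sum.swap) (simp add: sum_distrib_left)
    also have "\<dots> = A {} N + (\<Sum>T\<in>Pow S - {{}}. (\<Prod>i\<in>T. e i) * A T N)"
      using S by (subst sum.remove[of _ "{}"]) auto
    finally have 1: "W N = A {} N + (\<Sum>T\<in>Pow S - {{}}. (\<Prod>i\<in>T. e i) * A T N)" .
    have 2: "(\<Sum>T\<in>Pow S - {{}}. (\<Prod>i\<in>T. e i) * A T N) \<ge> (\<Sum>T\<in>Pow S - {{}}. - C T)"
    proof (rule sum_mono)
      fix T assume T: "T \<in> Pow S - {{}}"
      have "\<bar>(\<Prod>i\<in>T. e i) * A T N\<bar> \<le> C T" using C[of T N] abs_e[of T] T by (simp add: abs_mult)
      then show "- C T \<le> (\<Prod>i\<in>T. e i) * A T N" by linarith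
    qed
    have 3: "A {} N \<ge> ln N - 1" using mangoldt_log_sum_lower[OF that] by (simp add: A_def)
    show ?thesis using 1 2 3 by (simp add: sum_negf)
  qed
  define P where "P = (\<Prod>i\<in>S. M i)"
  have P: "P > 0" unfolding P_def using real_charD(1)[OF f] by (intro prod_pos) auto
  have w0: "0 \<le> e i * f i d + 1" "e i * f i d + 1 \<le> 2" if "i \<in> S" for i d
    using real_charD(5)[OF f[OF that], of d] e[OF that] by auto
  have w: "0 \<le> w d" "w d \<le> 2 ^ card S" for d
    unfolding w_def using w0 by (auto intro!: prod_nonneg prod_le_power)
  have wprime: "w d = 0" if d: "prime d" "\<not> d dvd P" for d
  proof -
    obtain i where i: "i \<in> S" "f i d \<noteq> e i" using none[OF d(1)] by blast
    have "M i dvd P" unfolding P_def using S i(1) by (rule dvd_prodI)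
    then have "coprime d (M i)" using d dvd_trans prime_imp_coprime by blast
    then have "f i d \<noteq> 0" using real_charD(7)[OF f[OF i(1)]] by blast
    then have "e i * f i d + 1 = 0" using real_charD(5)[OF f[OF i(1)], of d] e[OF i(1)] i(2) by auto
    then show ?thesis unfolding w_def using S i(1) by auto
  qed
  obtain C2 where C2: "\<And>N. (\<Sum>d\<in>{d\<in>{1..N}. \<not> prime d}. mangoldt d / real d) \<le> C2"
    using nonprime_mangoldt_bounded by blast
  \<comment> \<open>Covers the primes dividing a modulus, where some \<open>f i\<close> may be 0 and
    \<open>w\<close> need not vanish.\<close>
  define C3 where "C3 = (\<Sum>d | d dvd P. mangoldt d / real d :: real)"
  have mnn: "0 \<le> mangoldt d / real d" for d by (intro divide_nonneg_nonneg mangoldt_nonneg) simp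
  have upper: "W N \<le> 2 ^ card S * (C2 + C3)" for N
  proof -
    have "W N = (\<Sum>d=1..N. mangoldt d / real d * w d)" by (simp add: W_def)
    also have "\<dots> = (\<Sum>d\<in>{d\<in>{1..N}. \<not> prime d} \<union> {d\<in>{1..N}. d dvd P \<and> prime d}. mangoldt d / real d * w d)"
      using wprime by (intro sum.mono_neutral_right) auto
    also have "\<dots> = (\<Sum>d\<in>{d\<in>{1..N}. \<not> prime d}. mangoldt d / real d * w d)
                  + (\<Sum>d\<in>{d\<in>{1..N}. d dvd P \<and> prime d}. mangoldt d / real d * w d)"
      by (rule sum.union_disjoint) auto
    also have "\<dots> \<le> (\<Sum>d\<in>{d\<in>{1..N}. \<not> prime d}. mangoldt d / real d * 2 ^ card S)
                  + (\<Sum>d\<in>{d\<in>{1..N}. d dvd P \<and> prime d}. mangoldt d / real d * 2 ^ card S)"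
      by (intro add_mono sum_mono mult_left_mono w mnn)
    also have "\<dots> = 2 ^ card S * ((\<Sum>d\<in>{d\<in>{1..N}. \<not> prime d}. mangoldt d / real d)
                  + (\<Sum>d\<in>{d\<in>{1..N}. d dvd P \<and> prime d}. mangoldt d / real d))"
      by (simp add: sum_distrib_left distrib_left mult.commute)
    also have "\<dots> \<le> 2 ^ card S * (C2 + C3)"
    proof (intro mult_left_mono add_mono C2)
      show "(\<Sum>d\<in>{d\<in>{1..N}. d dvd P \<and> prime d}. mangoldt d / real d) \<le> C3"
        unfolding C3_def using P mnn by (intro sum_mono2) auto
    qed auto
    finally show ?thesis .
  qed
  define K where "K = 2 ^ card S * (C2 + C3) + 1 + (\<Sum>T\<in>Pow S - {{}}. C T)"
  obtain N where N: "real N > exp K" using reals_Archimedean2 by blast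
  then have N1: "N \<ge> 1" using exp_gt_zero[of K] by (cases N) (auto simp: not_le less_imp_le)
  have "K < ln N" using N N1 ln_less_cancel_iff[of "exp K" "real N"] by simp
  then show False using lower[OF N1] upper[of N] by (simp add: K_def)
qed

section \<open>Sums of three squares\<close>

lemma Legendre_values: "Legendre a p \<in> {-1, 0, 1}"
  by (auto simp: Legendre_def)

lemma Legendre_mod: "[a = b] (mod p) \<Longrightarrow> Legendre a p = Legendre b p"
  by (simp add: Legendre_def QuadRes_def cong_def)

text \<open>Lifts the congruences of Euler's criterion to equalities: two such values differ by at
  most 2, hence by less than \<open>p\<close>.\<close>

lemma small_cong_eq:
  fixes a b p :: int
  assumes "[a = b] (mod p)" "p > 2" "a \<in> {-1, 0, 1}" "b \<in> {-1, 0, 1}"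
  shows "a = b"
proof -
  have "p dvd a - b" using assms(1) by (simp add: cong_iff_dvd_diff)
  moreover have "\<bar>a - b\<bar> < p" using assms by auto
  ultimately show ?thesis using dvd_imp_le_int[of "a - b" p] assms by auto
qed

lemma Legendre_mult:
  assumes p: "prime p" "p > (2::nat)"
  shows "Legendre (a * b) p = Legendre a p * Legendre b p"
proof (rule small_cong_eq[where p = p])
  have "[Legendre (a * b) p = (a * b) ^ ((p - 1) div 2)] (mod p)" by (rule euler_criterion[OF p])
  moreover have "[Legendre a p * Legendre b p = a ^ ((p - 1) div 2) * b ^ ((p - 1) div 2)] (mod p)"
    by (intro cong_mult euler_criterion[OF p])
  ultimately show "[Legendre (a * b) p = Legendre a p * Legendre b p] (mod p)"
    by (metis cong_sym cong_trans power_mult_distrib)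
qed (use p Legendre_values[of a p] Legendre_values[of b p] Legendre_values[of "a * b" p] in auto)

text \<open>The nontrivial Dirichlet character modulo 4.\<close>

definition chi4 :: "nat \<Rightarrow> real" where
  "chi4 n = (if n mod 4 = 1 then 1 else if n mod 4 = 3 then -1 else 0)"

lemma chi4_mult: "chi4 (m * n) = chi4 m * chi4 n"
proof -
  have "(m * n) mod 4 = ((m mod 4) * (n mod 4)) mod 4" by (simp add: mod_mult_eq)
  moreover have "m mod 4 = 0 \<or> m mod 4 = 1 \<or> m mod 4 = 2 \<or> m mod 4 = 3"
    "n mod 4 = 0 \<or> n mod 4 = 1 \<or> n mod 4 = 2 \<or> n mod 4 = 3" by arith+
  ultimately show ?thesis unfolding chi4_def by (elim disjE) simp_all
qed

lemma chi4_eq_0_iff: "chi4 n = 0 \<longleftrightarrow> even n"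
proof -
  have "even n \<longleftrightarrow> n mod 4 = 0 \<or> n mod 4 = 2" by presburger
  moreover have "n mod 4 = 0 \<or> n mod 4 = 1 \<or> n mod 4 = 2 \<or> n mod 4 = 3" by arith
  ultimately show ?thesis by (auto simp: chi4_def)
qed

lemma real_char_chi4: "real_char 4 chi4"
proof -
  have "\<not> coprime n 4" if "even n" for n :: nat
    using that coprime_common_divisor[of n 4 2] by auto
  moreover have "chi4 n \<in> {-1, 0, 1}" "chi4 (n + 4) = chi4 n" for n by (auto simp: chi4_def)
  moreover have "chi4 1 = 1" by (simp add: chi4_def)
  ultimately show ?thesis
    unfolding real_char_def by (simp add: chi4_mult chi4_eq_0_iff)
qed

lemma real_char_Legendre:
  assumes p: "prime p" "p > (2::nat)"
  shows "real_char p (\<lambda>n. of_int (Legendre (int n) p))"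
  unfolding real_char_def
proof (intro conjI allI impI)
  show "p > 0" using p by simp
  show "real_of_int (Legendre (int 1) p) = 1"
  proof -
    have "\<not> [1 = 0] (mod int p)" using p by (simp add: cong_0_iff)
    moreover have "QuadRes (int p) 1" unfolding QuadRes_def by (rule exI[of _ 1]) simp
    ultimately show ?thesis by (simp add: Legendre_def)
  qed
  fix m n
  show "real_of_int (Legendre (int (m * n)) p) = real_of_int (Legendre (int m) p) * real_of_int (Legendre (int n) p)"
    by (simp add: Legendre_mult[OF p])
  show "real_of_int (Legendre (int (n + p)) p) = real_of_int (Legendre (int n) p)"
    by (subst Legendre_mod[of "int (n + p)" "int n"]) (auto simp: cong_def)
  show "real_of_int (Legendre (int n) p) \<in> {-1, 0, 1}" using Legendre_values[of n p] by auto
  assume "real_of_int (Legendre (int n) p) = 0"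
  then have "int p dvd int n" by (auto simp: Legendre_def cong_0_iff split: if_splits)
  then have "p dvd n" by simp
  then show "\<not> coprime n p" using p by (metis coprime_absorb_right not_prime_unit)
qed

text \<open>Squaring modulo \<open>p\<close> identifies 1 and \<open>p - 1\<close>, so it is not
  injective on the residues and therefore misses one.\<close>

lemma exists_nonresidue:
  assumes p: "prime p" "p > (2::nat)"
  obtains r :: nat where "Legendre r p = -1"
proof -
  define g where "g x = x\<^sup>2 mod p" for x :: nat
  have sub: "g ` {..<p} \<subseteq> {..<p}" using p by (auto simp: g_def)
  have "g 1 = g (p - 1)"
  proof -
    have "[int (p - 1) ^ 2 = 1 ^ 2] (mod int p)"
    proof -
      have "int (p - 1)^2 - 1 = int p * (int p - 2)"
        using p by (simp add: of_nat_diff power2_eq_square algebra_simps)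
      then show ?thesis by (simp add: cong_iff_dvd_diff)
    qed
    then have "[(p - 1)\<^sup>2 = 1\<^sup>2] (mod p)" by (metis cong_int_iff of_nat_1 of_nat_power)
    then show ?thesis by (simp add: g_def cong_def)
  qed
  then have "\<not> inj_on g {..<p}" using p inj_onD[of g "{..<p}" 1 "p - 1"] by auto
  then have "g ` {..<p} \<noteq> {..<p}" using eq_card_imp_inj_on[of "{..<p}" g] by auto
  then obtain r where r: "r < p" "r \<notin> g ` {..<p}" using sub by auto
  have nq: "\<not> QuadRes p r"
  proof
    assume "QuadRes p r"
    then obtain y where "[y\<^sup>2 = int r] (mod int p)" unfolding QuadRes_def by blast
    then have "[(y mod p)\<^sup>2 = int r] (mod int p)" by (simp add: cong_def power_mod)
    then have "[int ((nat (y mod p))\<^sup>2) = int r] (mod int p)" using p by simp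
    then have "[(nat (y mod p))\<^sup>2 = r] (mod p)" by (metis cong_int_iff)
    then have "g (nat (y mod p)) = r" using r by (simp add: g_def cong_def)
    moreover have "nat (y mod p) < p" using p by (simp add: nat_less_iff)
    ultimately show False using r by blast
  qed
  have "r \<noteq> 0" using r p by (metis g_def image_eqI lessThan_iff mod_0 power_zero_numeral gr0I not_less0)
  then have "\<not> [int r = 0] (mod p)" using r by (auto simp: cong_0_iff dest: zdvd_imp_le)
  then have "Legendre r p = -1" using nq by (simp add: Legendre_def)
  then show ?thesis by (rule that)
qed

lemma Legendre_minus_one:
  assumes p: "prime p" "p > (2::nat)" shows "of_int (Legendre (-1) p) = chi4 p"
proof -
  have "Legendre (-1) p = (-1) ^ ((p - 1) div 2)"
  proof (rule small_cong_eq[where p = p])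
    show "[Legendre (-1) p = (-1) ^ ((p - 1) div 2)] (mod p)" by (rule euler_criterion[OF p])
    show "(-1) ^ ((p - 1) div 2) \<in> {-1, 0, 1::int}" by (metis insertCI minus_one_power_iff)
  qed (use p Legendre_values in auto)
  moreover have "odd p" using p prime_odd_nat by blast
  then have "even ((p - 1) div 2) \<longleftrightarrow> p mod 4 = 1" "p mod 4 = 1 \<or> p mod 4 = 3" by presburger+
  ultimately show ?thesis by (auto simp: chi4_def minus_one_power_iff)
qed

text \<open>Prescribe that \<open>q\<close> has value 1 under \<open>chi4\<close> and has the same
  Legendre symbol as -1 modulo every prime divisor of \<open>n\<close>. Multiplicativity then gives
  the value 1 at \<open>- q\<close>.\<close>

lemma exists_prime_Legendre:
  assumes n: "odd n" "n > (0::nat)"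
  obtains q :: nat where "prime q" "q mod 4 = 1" "\<And>p. prime p \<Longrightarrow> p dvd n \<Longrightarrow> Legendre (- int q) p = 1"
proof -
  \<comment> \<open>The index 2 stands for the character modulo 4, any other index for the Legendre
    symbol modulo that prime; as \<open>n\<close> is odd, the two uses do not collide.\<close>
  define S where "S = insert 2 (prime_factors n)"
  define M where "M p = (if p = 2 then 4 else p)" for p :: nat
  define f where "f p = (if p = 2 then chi4 else (\<lambda>m. of_int (Legendre (int m) (int p))))" for p :: nat
  define e where "e p = (if p = 2 then 1 else of_int (Legendre (-1) (int p)) :: real)" for p :: nat
  have p2: "p > 2" "prime p" "p dvd n" if "p \<in> S" "p \<noteq> 2" for p
  proof -
    show "prime p" "p dvd n" using that by (auto simp: S_def in_prime_factors_iff)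
    then show "p > 2" using that prime_ge_2_nat[of p] by simp
  qed
  have prS: "prime p" if "p \<in> S" for p using p2[OF that] two_is_prime_nat by blast
  have fin: "finite S" by (simp add: S_def)
  have ch: "real_char (M p) (f p)" if "p \<in> S" for p
    using p2[OF that] by (auto simp: M_def f_def real_char_chi4 intro!: real_char_Legendre)
  have eval: "e p \<in> {-1, 1}" if "p \<in> S" for p
  proof (cases "p = 2")
    case False
    have "chi4 p \<noteq> 0" using p2[OF that False] prime_odd_nat by (auto simp: chi4_eq_0_iff)
    then show ?thesis using False p2[OF that False] Legendre_values[of "-1" p] Legendre_minus_one[of p] by (auto simp: e_def)
  qed (simp add: e_def)
  have cop: "coprime (M i) (M j)" if "i \<in> S" "j \<in> S" "i \<noteq> j" for i j
  proof -
    have "coprime i j" using that prS primes_coprime by blast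
    moreover have "coprime 4 k \<longleftrightarrow> coprime 2 k" "coprime k 4 \<longleftrightarrow> coprime k 2" for k :: nat
      using coprime_power_left_iff[of 2 2 k] coprime_power_right_iff[of k 2 2] by simp_all
    ultimately show ?thesis using that unfolding M_def by (cases "i = 2"; cases "j = 2") auto
  qed
  have bad: "\<exists>r. f p r = -1" if pS: "p \<in> S" for p
  proof (cases "p = 2")
    case True
    then show ?thesis by (intro exI[of _ 3]) (simp add: f_def chi4_def)
  next
    case False
    obtain r :: nat where "Legendre r p = -1" using exists_nonresidue[of p] p2[OF pS False] by blast
    then show ?thesis using False by (intro exI[of _ r]) (simp add: f_def)
  qed
  have cop_iff: "coprime b (M p)" if "p \<in> S" "f p b \<noteq> 0" for p b
  proof (cases "p = 2")
    case True
    then have "odd b" using that by (auto simp: f_def chi4_eq_0_iff)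
    then show ?thesis using True coprime_power_right_iff[of b 2 2] by (simp add: M_def)
  next
    case False
    then have "\<not> p dvd b" using that by (auto simp: f_def Legendre_def cong_0_iff split: if_splits)
    then show ?thesis using False p2[OF that(1) False] by (metis M_def coprime_commute prime_imp_coprime)
  qed
  have indep: "\<exists>b. coprime b (\<Prod>i\<in>T. M i) \<and> (\<Prod>i\<in>T. f i b) = -1" if T: "T \<subseteq> S" "T \<noteq> {}" for T
  proof -
    obtain j where j: "j \<in> T" using T by blast
    obtain r where r: "f j r = -1" using bad j T by blast
    have finT: "finite T" using T fin finite_subset by blast
    \<comment> \<open>The number \<open>b\<close> makes one chosen factor equal to -1 and, being 1
      modulo the other moduli, leaves the remaining factors at 1.\<close>
    obtain b where b: "\<forall>i\<in>T. [b = (if i = j then r else 1)] (mod M i)"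
      using chinese_remainder_nat[OF finT, of M "\<lambda>i. if i = j then r else 1"] cop T by blast
    have fb: "f i b = (if i = j then -1 else 1)" if "i \<in> T" for i
    proof -
      have "f i b = f i (if i = j then r else 1)"
        using b that real_char_mod[OF ch[of i]] T unfolding cong_def by (metis subsetD)
      then show ?thesis using r real_charD(2)[OF ch[of i]] T that by auto
    qed
    have "(\<Prod>i\<in>T. f i b) = (\<Prod>i\<in>T. if i = j then -1 else 1)" using fb by (intro prod.cong) auto
    also have "\<dots> = -1" using finT j by simp
    finally have "(\<Prod>i\<in>T. f i b) = -1" .
    moreover have "coprime b (\<Prod>i\<in>T. M i)"
      using T fb by (intro prod_coprime_right cop_iff) auto
    ultimately show ?thesis by blast
  qed
  obtain q where q: "prime q" "\<forall>i\<in>S. f i q = e i"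
    using exists_prime_real_chars[where M = M and f = f and e = e, OF fin] ch eval indep by blast
  have "f 2 q = e 2" using q by (simp add: S_def)
  then have "q mod 4 = 1" by (auto simp: f_def e_def chi4_def split: if_splits)
  moreover have "Legendre (- int q) p = 1" if "prime p" "p dvd n" for p
  proof -
    have "p \<in> S" using that n by (simp add: S_def in_prime_factors_iff)
    moreover have np: "p \<noteq> 2" using that n by auto
    ultimately have "real_of_int (Legendre q p) = real_of_int (Legendre (-1) p)" using q by (auto simp: f_def e_def)
    then have "Legendre q p = Legendre (-1) p" by simp
    moreover have pp: "p > 2" using that np prime_ge_2_nat[of p] by simp
    have "Legendre (- int q) p = Legendre (-1) p * Legendre q p"
      using Legendre_mult[OF that(1) pp, of "-1" q] by simp
    moreover have "Legendre (-1) p \<in> {-1, 1}"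
      using eval[OF \<open>p \<in> S\<close>] np by (auto simp: e_def)
    ultimately show ?thesis by auto
  qed
  ultimately show ?thesis using that q by blast
qed

section \<open>Square roots and small solutions of congruences\<close>

lemma not_squarefree_0: "\<not> squarefree (0::nat)"
  by (auto simp: squarefree_def intro!: exI[of _ 2])

text \<open>Squarefreeness makes a prime factor coprime to its cofactor, so square roots can be
  glued by the Chinese remainder theorem.\<close>

lemma sqrt_mod_squarefree:
  fixes n :: nat and c :: int
  assumes "squarefree n" "\<And>p. prime p \<Longrightarrow> p dvd n \<Longrightarrow> \<exists>y. [y\<^sup>2 = c] (mod int p)"
  shows "\<exists>y. [y\<^sup>2 = c] (mod int n)"
  using assms
proof (induction n rule: less_induct)
  case (less n)
  have n0: "n \<noteq> 0" using less.prems(1) not_squarefree_0 by metis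
  show ?case
  proof (cases "n = 1")
    case False
    then obtain p where p: "prime p" "p dvd n" using prime_factor_nat by blast
    then obtain m where m: "n = p * m" by blast
    have "\<not> p dvd m" using less.prems(1) p(1) m by (metis dvd_triv_left mult_dvd_mono dvd_refl not_prime_unit power2_eq_square squarefree_def)
    then have cop: "coprime (int p) (int m)" using p(1) prime_imp_coprime by auto
    have "m < n" using m n0 p(1) prime_gt_1_nat[of p] by simp
    moreover have "squarefree m" using less.prems(1) m by (metis squarefree_multD(2))
    ultimately obtain y where y: "[y\<^sup>2 = c] (mod int m)"
      using less.IH[of m] less.prems(2) m by (metis dvd_triv_right dvd_trans)
    obtain z where z: "[z\<^sup>2 = c] (mod int p)" using less.prems(2) p by blast
    obtain x where x: "[x = z] (mod int p)" "[x = y] (mod int m)"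
      using binary_chinese_remainder_int[OF cop] by blast
    have "[x\<^sup>2 = c] (mod int p)" "[x\<^sup>2 = c] (mod int m)"
      using x y z cong_pow cong_trans by blast+
    then have "[x\<^sup>2 = c] (mod int p * int m)" using cop by (simp add: coprime_cong_mult)
    then show ?thesis using m by auto
  qed auto
qed

text \<open>A form of Thue's lemma: the box holds more points than there are pairs of residues, and
  the difference of two colliding points satisfies both congruences.\<close>

lemma pigeonhole_residues:
  fixes n q a b c :: nat and k l :: int
  assumes "n > 0" "q > 0" "n * q < (a + 1) * (b + 1) * (c + 1)"
  obtains X Y Z :: int where "(X, Y, Z) \<noteq> (0, 0, 0)" "\<bar>X\<bar> \<le> a" "\<bar>Y\<bar> \<le> b" "\<bar>Z\<bar> \<le> c"
    "int n dvd Y - k * Z" "int q dvd Y - l * X"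
proof -
  define D where "D = {0..int a} \<times> {0..int b} \<times> {0..int c}"
  define g where "g = (\<lambda>(x, y, z). ((y - k * z) mod int n, (y - l * x) mod int q))"
  have "g ` D \<subseteq> {0..<int n} \<times> {0..<int q}" using assms by (auto simp: g_def)
  then have "card (g ` D) \<le> n * q" using card_mono[of "{0..<int n} \<times> {0..<int q}"] by (simp add: card_cartesian_product)
  moreover have "card D = (a + 1) * (b + 1) * (c + 1)" by (simp add: D_def card_cartesian_product nat_add_distrib algebra_simps)
  ultimately have "\<not> inj_on g D" using assms by (intro pigeonhole) simp
  then obtain u v where uv: "u \<in> D" "v \<in> D" "g u = g v" "u \<noteq> v" unfolding inj_on_def by blast
  obtain x y z x' y' z' where xyz: "u = (x, y, z)" "v = (x', y', z')" by (cases u, cases v) auto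
  have "int n dvd (y - k * z) - (y' - k * z')" "int q dvd (y - l * x) - (y' - l * x')"
    using uv(3) by (auto simp: xyz g_def mod_eq_dvd_iff)
  then have "int n dvd (y - y') - k * (z - z')" "int q dvd (y - y') - l * (x - x')"
    by (simp_all add: algebra_simps)
  then show ?thesis
    using that[of "x - x'" "y - y'" "z - z'"] uv(1,2,4) by (auto simp: xyz D_def)
qed

lemma floor_sqrt_exists:
  obtains a :: nat where "a\<^sup>2 \<le> n" "n < (a + 1)\<^sup>2"
proof -
  define a where "a = nat \<lfloor>sqrt n\<rfloor>"
  have a: "real a \<le> sqrt n" "sqrt n < real a + 1" by (auto simp: a_def)
  have "(real a)\<^sup>2 \<le> n" using a(1) power_mono[OF a(1), of 2] by simp
  moreover have "real n < (real a + 1)\<^sup>2" using power_strict_mono[OF a(2), of 2] by simp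
  ultimately show ?thesis using that[of a]
    by (metis of_nat_1 of_nat_add of_nat_le_iff of_nat_less_iff of_nat_power)
qed

lemma prime_not_square_int: "prime (q::nat) \<Longrightarrow> x\<^sup>2 \<noteq> int q"
proof
  assume q: "prime q" "x\<^sup>2 = int q"
  then have "q = (nat \<bar>x\<bar>)\<^sup>2" by (metis nat_abs_mult_distrib nat_int power2_abs power2_eq_square nat_power_eq abs_ge_zero)
  then show False using q(1) by (auto simp: prime_power_iff)
qed

lemma prime_sum_two_squares:
  fixes q :: nat
  assumes q: "prime q" "q mod 4 = 1"
  obtains c d :: int where "int q = c\<^sup>2 + d\<^sup>2"
proof -
  have q2: "q > 2" using q prime_ge_2_nat[of q] by (cases "q = 2") auto
  have "Legendre (-1) q = 1" using Legendre_minus_one[OF q(1) q2] q(2) by (simp add: chi4_def)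
  then have "QuadRes q (-1)" by (auto simp: Legendre_def split: if_splits)
  then obtain k where k: "[k\<^sup>2 = -1] (mod int q)" unfolding QuadRes_def by blast
  obtain a :: nat where a: "a\<^sup>2 \<le> q" "q < (a + 1)\<^sup>2" by (rule floor_sqrt_exists)
  \<comment> \<open>Second modulus 1 and bound 0 for \<open>X\<close> leave the classical
    two-variable case. The sum of the squares of \<open>Y\<close> and \<open>Z\<close> is then a
    multiple of \<open>q\<close> strictly between 0 and \<open>2 * q\<close>.\<close>
  obtain X Y Z :: int where XYZ: "(X, Y, Z) \<noteq> (0, 0, 0)" "\<bar>X\<bar> \<le> int 0" "\<bar>Y\<bar> \<le> a" "\<bar>Z\<bar> \<le> a" "int q dvd Y - k * Z"
    using pigeonhole_residues[of q 1 0 a a k 0] a q2 by (auto simp: power2_eq_square)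
  have b: "w\<^sup>2 < int q" if "\<bar>w\<bar> \<le> int a" for w
  proof -
    have "w\<^sup>2 \<le> (int a)\<^sup>2" using that by (simp flip: abs_le_square_iff)
    also have "\<dots> \<le> int q" using a(1) by (metis of_nat_le_iff of_nat_power)
    finally show ?thesis using prime_not_square_int[OF q(1), of w] by linarith
  qed
  have "[Y = k * Z] (mod int q)" using XYZ by (simp add: cong_iff_dvd_diff)
  then have "[Y\<^sup>2 = (k * Z)\<^sup>2] (mod int q)" by (rule cong_pow)
  also have "(k * Z)\<^sup>2 = k\<^sup>2 * Z\<^sup>2" by (simp add: power_mult_distrib)
  also have "[k\<^sup>2 * Z\<^sup>2 = -1 * Z\<^sup>2] (mod int q)" using k by (rule cong_scalar_right)
  finally have "int q dvd Y\<^sup>2 + Z\<^sup>2" by (simp add: cong_iff_dvd_diff)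
  then obtain t where t: "Y\<^sup>2 + Z\<^sup>2 = int q * t" by blast
  have "Y\<^sup>2 + Z\<^sup>2 > 0" using XYZ by (auto simp: sum_power2_gt_zero_iff)
  moreover have "Y\<^sup>2 + Z\<^sup>2 < int q * 2" using b[OF XYZ(3)] b[OF XYZ(4)] by simp
  ultimately have "0 < t" "t < 2" unfolding t using q2 by (auto simp: zero_less_mult_iff)
  then have "t = 1" by simp
  then have "int q = Y\<^sup>2 + Z\<^sup>2" using t by simp
  then show ?thesis by (rule that)
qed

text \<open>Both sides are completely multiplicative in \<open>n\<close>, so agreement at its prime
  factors suffices.\<close>

lemma Legendre_eq_chi4:
  assumes q: "prime q" "q mod 4 = (1::nat)"
    and agree: "\<And>p. prime p \<Longrightarrow> p dvd n \<Longrightarrow> of_int (Legendre (int p) q) = chi4 p"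
    and "n > 0"
  shows "of_int (Legendre (int n) q) = chi4 n"
proof -
  have q2: "q > 2" using q prime_ge_2_nat[of q] by (cases "q = 2") auto
  show ?thesis
    using agree \<open>n > 0\<close>
  proof (induction n rule: less_induct)
    case (less n)
    show ?case
    proof (cases "n = 1")
      case True
      then show ?thesis using real_charD(2)[OF real_char_Legendre[OF q(1) q2]] by (simp add: chi4_def)
    next
      case False
      then obtain p where p: "prime p" "p dvd n" using prime_factor_nat by blast
      then obtain m where m: "n = p * m" by blast
      have "m < n" "m > 0" using m less.prems(2) prime_gt_1_nat[OF p(1)] by auto
      moreover have "\<And>p. prime p \<Longrightarrow> p dvd m \<Longrightarrow> of_int (Legendre (int p) q) = chi4 p"
        using less.prems(1) m by simp
      ultimately have "of_int (Legendre (int m) q) = chi4 m" using less.IH[of m] by blast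
      moreover have "of_int (Legendre (int n) q) = (of_int (Legendre (int p) q) * of_int (Legendre (int m) q) :: real)"
        unfolding m using Legendre_mult[OF q(1) q2, of "int p" "int m"] by simp
      ultimately show ?thesis using less.prems(1)[OF p] by (simp only: m chi4_mult)
    qed
  qed
qed

text \<open>For the prime \<open>q\<close> of \<open>exists_prime_Legendre\<close>, a small nonzero
  point makes the form \<open>F\<close> divisible by \<open>n * q\<close> with
  \<open>-2 * n * q < F < n * q\<close>. So \<open>F\<close> is 0 or \<open>- n * q\<close>. Either
  case represents \<open>n\<close> times a nonzero square by the form Y^2 + q Z^2, and
  \<open>q\<close> is a sum of two squares.\<close>

lemma sum_three_squares_scaled:
  assumes n: "squarefree n" "n mod 4 = (1::nat)"
  obtains X a b c :: int where "X \<noteq> 0" "int n * X\<^sup>2 = a\<^sup>2 + b\<^sup>2 + c\<^sup>2"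
proof -
  have n0: "odd n" "n > 0" using n(2) by presburger+
  obtain q :: nat where q: "prime q" "q mod 4 = 1"
    and Lq: "\<And>p. prime p \<Longrightarrow> p dvd n \<Longrightarrow> Legendre (- int q) p = 1"
    using exists_prime_Legendre[OF n0] by blast
  have q2: "q > 2" using q prime_ge_2_nat[of q] by (cases "q = 2") auto
  have pn: "p > 2" if "prime p" "p dvd n" for p :: nat
    using that n0 prime_ge_2_nat[of p] by (cases "p = 2") auto
  \<comment> \<open>Since q is 1 modulo 4, reciprocity carries no sign; combined with the value 1 of
    the symbol of \<open>- q\<close> modulo \<open>p\<close> this leaves the symbol of -1.\<close>
  have agree: "of_int (Legendre (int p) q) = chi4 p" if p: "prime p" "p dvd n" for p
  proof -
    have "q \<noteq> p"
    proof
      assume "q = p"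
      then have "Legendre (- int q) p = 0" by (simp add: Legendre_def cong_0_iff)
      then show False using Lq[OF p] by simp
    qed
    then have "Legendre p q * Legendre q p = (-1) ^ ((p - 1) div 2 * ((q - 1) div 2))"
      using q p pn q2 by (intro Quadratic_Reciprocity) auto
    moreover have "even ((q - 1) div 2)" using q(2) by presburger
    ultimately have 1: "Legendre p q * Legendre q p = 1" by simp
    have 2: "Legendre (-1) p * Legendre q p = 1"
      using Lq[OF p] Legendre_mult[OF p(1) pn[OF p], of "-1" q] by simp
    have "Legendre q p \<in> {-1, 0, 1}" by (rule Legendre_values)
    with 1 2 have "Legendre p q = Legendre (-1) p" by auto
    then show ?thesis using Legendre_minus_one[OF p(1) pn[OF p]] by simp
  qed
  have "chi4 n = 1" using n(2) by (simp add: chi4_def)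
  then have "Legendre n q = 1" using Legendre_eq_chi4[OF q agree n0(2)] by simp
  then have ndq: "\<not> [int n = 0] (mod q)" and "QuadRes q n" by (auto simp: Legendre_def split: if_splits)
  then obtain l where l: "[l\<^sup>2 = int n] (mod int q)" unfolding QuadRes_def by blast
  have "\<exists>y. [y\<^sup>2 = - int q] (mod int p)" if "prime p" "p dvd n" for p
    using Lq[OF that] unfolding Legendre_def QuadRes_def by (auto split: if_splits)
  then obtain k where k: "[k\<^sup>2 = - int q] (mod int n)" using sqrt_mod_squarefree[OF n(1)] by blast
  \<comment> \<open>The sides of the box are about the square roots of q, nq and n. It then has more
    than nq points, while each of the three terms of \<open>F\<close> stays at most nq in absolute
    value.\<close>
  obtain a :: nat where a: "a\<^sup>2 \<le> q" "q < (a + 1)\<^sup>2" by (rule floor_sqrt_exists)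
  obtain b :: nat where b: "b\<^sup>2 \<le> n * q" "n * q < (b + 1)\<^sup>2" by (rule floor_sqrt_exists)
  obtain c :: nat where c: "c\<^sup>2 \<le> n" "n < (c + 1)\<^sup>2" by (rule floor_sqrt_exists)
  have "n * q < (a + 1) * (b + 1) * (c + 1)"
  proof (rule power_less_imp_less_base)
    have "(n * q)\<^sup>2 = q * (n * q) * n" by (simp add: power2_eq_square)
    also have "\<dots> < (a + 1)\<^sup>2 * (b + 1)\<^sup>2 * (c + 1)\<^sup>2"
      using a b c by (intro mult_strict_mono) auto
    finally show "(n * q)\<^sup>2 < ((a + 1) * (b + 1) * (c + 1))\<^sup>2" by (simp only: power_mult_distrib)
  qed simp
  then obtain X Y Z :: int where XYZ: "(X, Y, Z) \<noteq> (0, 0, 0)" "\<bar>X\<bar> \<le> a" "\<bar>Y\<bar> \<le> b" "\<bar>Z\<bar> \<le> c"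
    "int n dvd Y - k * Z" "int q dvd Y - l * X"
    using pigeonhole_residues[of n q a b c k l] n0 q2 by auto
  define F where "F = int n * X\<^sup>2 - Y\<^sup>2 - int q * Z\<^sup>2"
  have "int n dvd F"
  proof -
    have "[Y = k * Z] (mod int n)" using XYZ by (simp add: cong_iff_dvd_diff)
    then have "[Y\<^sup>2 = (k * Z)\<^sup>2] (mod int n)" by (rule cong_pow)
    also have "(k * Z)\<^sup>2 = k\<^sup>2 * Z\<^sup>2" by (simp add: power_mult_distrib)
    also have "[k\<^sup>2 * Z\<^sup>2 = - int q * Z\<^sup>2] (mod int n)" using k by (rule cong_scalar_right)
    finally have "int n dvd Y\<^sup>2 + int q * Z\<^sup>2" by (simp add: cong_iff_dvd_diff)
    then have "int n dvd int n * X\<^sup>2 - (Y\<^sup>2 + int q * Z\<^sup>2)" by (intro dvd_diff) auto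
    then show ?thesis by (simp add: F_def algebra_simps)
  qed
  moreover have "int q dvd F"
  proof -
    have "[Y = l * X] (mod int q)" using XYZ by (simp add: cong_iff_dvd_diff)
    then have "[Y\<^sup>2 = (l * X)\<^sup>2] (mod int q)" by (rule cong_pow)
    also have "(l * X)\<^sup>2 = l\<^sup>2 * X\<^sup>2" by (simp add: power_mult_distrib)
    also have "[l\<^sup>2 * X\<^sup>2 = int n * X\<^sup>2] (mod int q)" using l by (rule cong_scalar_right)
    finally have "int q dvd Y\<^sup>2 - int n * X\<^sup>2" by (simp add: cong_iff_dvd_diff)
    then have "int q dvd - (Y\<^sup>2 - int n * X\<^sup>2) - int q * Z\<^sup>2" by (intro dvd_diff) (simp only: dvd_minus_iff, simp)
    then show ?thesis by (simp add: F_def algebra_simps)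
  qed
  moreover have "coprime (int n) (int q)"
    using ndq q(1) prime_imp_coprime[of "int q" "int n"] by (simp add: cong_0_iff coprime_commute del: coprime_int_iff)
  ultimately have "int n * int q dvd F" by (simp add: divides_mult)
  then obtain t where t: "F = int n * int q * t" by blast
  have sq: "w\<^sup>2 \<le> int m" if "\<bar>w\<bar> \<le> int r" "r\<^sup>2 \<le> m" for w r m
  proof -
    have "w\<^sup>2 \<le> (int r)\<^sup>2" using that(1) by (simp flip: abs_le_square_iff)
    also have "\<dots> \<le> int m" using that(2) by (metis of_nat_le_iff of_nat_power)
    finally show ?thesis .
  qed
  have bX: "X\<^sup>2 < int q" using sq[OF XYZ(2) a(1)] prime_not_square_int[OF q(1), of X] by linarith
  have bY: "Y\<^sup>2 \<le> int n * int q" using sq[OF XYZ(3) b(1)] by simp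
  have bZ: "Z\<^sup>2 \<le> int n" by (rule sq[OF XYZ(4) c(1)])
  have bZ': "int q * Z\<^sup>2 \<le> int n * int q" using mult_left_mono[OF bZ, of "int q"] by (simp add: mult.commute)
  have nq: "int n * int q > 0" using n0 q2 by simp
  have "F < int n * int q"
  proof -
    have "int n * X\<^sup>2 < int n * int q" using bX n0 by simp
    moreover have "0 \<le> Y\<^sup>2" "0 \<le> int q * Z\<^sup>2" by simp_all
    ultimately show ?thesis unfolding F_def by linarith
  qed
  then have "int n * int q * t < int n * int q * 1" using t by simp
  then have "t < 1" using nq by (simp only: mult_less_cancel_left_pos)
  \<comment> \<open>Rules out the extreme value \<open>F = -2 * n * q\<close>, since equality would
    make \<open>q\<close> divide \<open>n\<close>.\<close>
  have Y2: "Y\<^sup>2 \<noteq> int n * int q"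
  proof
    assume Y: "Y\<^sup>2 = int n * int q"
    then have "int q dvd Y\<^sup>2" by simp
    then have "int q dvd Y" using q(1) prime_dvd_power by (metis prime_nat_int_transfer)
    then have "int q * int q dvd int n * int q" by (metis Y mult_dvd_mono power2_eq_square)
    then have "int q dvd int n" using q2 by simp
    then show False using ndq by (simp add: cong_0_iff)
  qed
  have "F > - 2 * (int n * int q)"
  proof -
    have "0 \<le> int n * X\<^sup>2" by simp
    then show ?thesis using bY bZ' Y2 unfolding F_def by linarith
  qed
  then have "int n * int q * (-2) < int n * int q * t" using t by simp
  then have "-2 < t" using nq by (simp only: mult_less_cancel_left_pos)
  obtain u v :: int where uv: "int q = u\<^sup>2 + v\<^sup>2" by (rule prime_sum_two_squares[OF q])
  from \<open>t < 1\<close> \<open>-2 < t\<close> consider "t = 0" | "t = -1" by linarith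
  then show ?thesis
  proof cases
    case 1
    then have F0: "int n * X\<^sup>2 = Y\<^sup>2 + int q * Z\<^sup>2" using t by (simp add: F_def)
    have "X \<noteq> 0"
    proof
      assume "X = 0"
      then have "Y\<^sup>2 + int q * Z\<^sup>2 = 0" using F0 by simp
      moreover have "int q * Z\<^sup>2 \<ge> 0" "Y\<^sup>2 \<ge> 0" by simp_all
      ultimately have "Y\<^sup>2 = 0" "int q * Z\<^sup>2 = 0" by linarith+
      then show False using XYZ(1) \<open>X = 0\<close> q2 by simp
    qed
    moreover have "int n * X\<^sup>2 = Y\<^sup>2 + (u * Z)\<^sup>2 + (v * Z)\<^sup>2"
      by (simp add: F0 uv power_mult_distrib distrib_right)
    ultimately show ?thesis by (rule that)
  next
    case 2
    then have F1: "int n * (X\<^sup>2 + int q) = Y\<^sup>2 + int q * Z\<^sup>2" using t by (simp add: F_def algebra_simps)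
    have "X\<^sup>2 + int q \<noteq> 0" using q2 zero_le_power2[of X] by linarith
    \<comment> \<open>Brahmagupta's identity for the norm form Y^2 + q Z^2: multiplying the relation
      by X^2 + q turns the left side into \<open>n\<close> times a square.\<close>
    moreover have "int n * (X\<^sup>2 + int q)\<^sup>2 = (X * Y + int q * Z)\<^sup>2 + (u * (Y - X * Z))\<^sup>2 + (v * (Y - X * Z))\<^sup>2"
    proof -
      have "int n * (X\<^sup>2 + int q)\<^sup>2 = (Y\<^sup>2 + int q * Z\<^sup>2) * (X\<^sup>2 + int q)"
        unfolding F1 [symmetric] by (simp add: power2_eq_square)
      also have "\<dots> = (X * Y + int q * Z)\<^sup>2 + int q * (Y - X * Z)\<^sup>2" by (simp add: power2_eq_square algebra_simps)
      also have "int q * (Y - X * Z)\<^sup>2 = (u * (Y - X * Z))\<^sup>2 + (v * (Y - X * Z))\<^sup>2"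
        by (simp add: uv power_mult_distrib distrib_right)
      finally show ?thesis by simp
    qed
    ultimately show ?thesis by (rule that)
  qed
qed

section \<open>Orthogonal pairs in rational five-space\<close>

definition rat_three_squares :: "real \<Rightarrow> bool" where
  "rat_three_squares r \<longleftrightarrow> (\<exists>a\<in>\<rat>. \<exists>b\<in>\<rat>. \<exists>c\<in>\<rat>. r = a\<^sup>2 + b\<^sup>2 + c\<^sup>2)"

definition rat_four_squares :: "real \<Rightarrow> bool" where
  "rat_four_squares r \<longleftrightarrow> (\<exists>a\<in>\<rat>. \<exists>b\<in>\<rat>. \<exists>c\<in>\<rat>. \<exists>d\<in>\<rat>. r = a\<^sup>2 + b\<^sup>2 + c\<^sup>2 + d\<^sup>2)"

lemma rat_three_squares_scale:
  assumes "rat_three_squares r" "t \<in> \<rat>" shows "rat_three_squares (r * t\<^sup>2)"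
proof -
  obtain a b c where "a \<in> \<rat>" "b \<in> \<rat>" "c \<in> \<rat>" "r = a\<^sup>2 + b\<^sup>2 + c\<^sup>2"
    using assms(1) by (auto simp: rat_three_squares_def)
  with assms(2) show ?thesis unfolding rat_three_squares_def
    by (intro bexI[of _ "a * t"] bexI[of _ "b * t"] bexI[of _ "c * t"]) (auto simp: power_mult_distrib distrib_right)
qed

lemma rat_four_squares_scale:
  assumes "rat_four_squares r" "t \<in> \<rat>" shows "rat_four_squares (r * t\<^sup>2)"
proof -
  obtain a b c d where "a \<in> \<rat>" "b \<in> \<rat>" "c \<in> \<rat>" "d \<in> \<rat>" "r = a\<^sup>2 + b\<^sup>2 + c\<^sup>2 + d\<^sup>2"
    using assms(1) by (auto simp: rat_four_squares_def)
  with assms(2) show ?thesis unfolding rat_four_squares_def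
    by (intro bexI[of _ "a * t"] bexI[of _ "b * t"] bexI[of _ "c * t"] bexI[of _ "d * t"])
       (auto simp: power_mult_distrib distrib_right)
qed

lemma squarefree_decomposition:
  fixes n :: nat assumes "n > 0"
  obtains s t where "n = s * t\<^sup>2" "squarefree s" "s > 0" "t > 0" "s mod 4 \<noteq> 0"
proof -
  define s where "s = squarefree_part n"
  define t where "t = square_part n"
  have n: "n = s * t\<^sup>2" unfolding s_def t_def by (rule squarefree_decompose)
  have sf: "squarefree s" by (simp add: s_def squarefree_squarefree_part)
  have "s mod 4 \<noteq> 0"
  proof
    assume "s mod 4 = 0"
    then have "(2::nat)\<^sup>2 dvd s" by auto
    then have "is_unit (2::nat)" using sf unfolding squarefree_def by blast
    then show False by simp
  qed
  moreover have "s > 0" "t > 0" using n assms by (auto intro: Nat.gr0I)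
  ultimately show ?thesis using that n sf by blast
qed

text \<open>The square part of \<open>n\<close> is odd, hence its square is 1 modulo 4 and the
  squarefree part inherits the residue of \<open>n\<close>; rational scaling absorbs the
  squares.\<close>

lemma rat_three_squares_mod4:
  fixes n :: nat assumes "n mod 4 = 1" shows "rat_three_squares (real n)"
proof -
  have "n > 0" using assms by (cases n) auto
  then obtain s t where st: "n = s * t\<^sup>2" "squarefree s" "t > 0"
    by (rule squarefree_decomposition)
  have "odd n" using assms by presburger
  then have "odd t" using st(1) by auto
  then have "t mod 4 = 1 \<or> t mod 4 = 3" by presburger
  then have "t\<^sup>2 mod 4 = 1" by (auto simp: power2_eq_square mod_mult_eq [symmetric, of t t])
  then have "s mod 4 = 1" using assms unfolding st(1) by (metis mod_mult_right_eq mult.right_neutral)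
  then obtain X a b c :: int where X: "X \<noteq> 0" "int s * X\<^sup>2 = a\<^sup>2 + b\<^sup>2 + c\<^sup>2"
    by (rule sum_three_squares_scaled[OF st(2)])
  have "real_of_int (int s * X\<^sup>2) = real_of_int (a\<^sup>2 + b\<^sup>2 + c\<^sup>2)" by (simp only: X(2))
  then have "real s * (real_of_int X)\<^sup>2 = (real_of_int a)\<^sup>2 + (real_of_int b)\<^sup>2 + (real_of_int c)\<^sup>2" by simp
  then have "rat_three_squares (real s * (real_of_int X)\<^sup>2)"
    unfolding rat_three_squares_def by (intro bexI[of _ "real_of_int a"] bexI[of _ "real_of_int b"] bexI[of _ "real_of_int c"]) auto
  then have "rat_three_squares (real s * (real_of_int X)\<^sup>2 * (real t / real_of_int X)\<^sup>2)"
    by (rule rat_three_squares_scale) auto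
  also have "real s * (real_of_int X)\<^sup>2 * (real t / real_of_int X)\<^sup>2 = real n"
    using X(1) by (simp add: st(1) power_divide)
  finally show ?thesis .
qed

section \<open>Sums of four rational squares\<close>

lemma rat_four_squares_add_square:
  assumes "rat_three_squares r" "t \<in> \<rat>" shows "rat_four_squares (r + t\<^sup>2)"
  using assms unfolding rat_three_squares_def rat_four_squares_def by blast

lemma rat_four_squares_half:
  assumes "rat_four_squares (2 * r)" shows "rat_four_squares r"
proof -
  obtain a b c d where abcd: "a \<in> \<rat>" "b \<in> \<rat>" "c \<in> \<rat>" "d \<in> \<rat>" "2 * r = a\<^sup>2 + b\<^sup>2 + c\<^sup>2 + d\<^sup>2"
    using assms by (auto simp: rat_four_squares_def)
  have "r = ((a + b) / 2)\<^sup>2 + ((a - b) / 2)\<^sup>2 + ((c + d) / 2)\<^sup>2 + ((c - d) / 2)\<^sup>2"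
    using abcd(5) by (simp add: power2_eq_square field_simps)
  with abcd show ?thesis unfolding rat_four_squares_def
    by (intro bexI[of _ "(a + b) / 2"] bexI[of _ "(a - b) / 2"] bexI[of _ "(c + d) / 2"] bexI[of _ "(c - d) / 2"]) auto
qed

lemma rat_four_squares_mod4:
  fixes n :: nat assumes "n mod 4 = 2" shows "rat_four_squares (real n)"
proof -
  obtain m where m: "n = Suc m" using assms by (cases n) auto
  then have "m mod 4 = 1" using assms by presburger
  then have "rat_four_squares (real m + 1\<^sup>2)"
    by (intro rat_four_squares_add_square rat_three_squares_mod4) auto
  then show ?thesis by (simp add: m add.commute)
qed

text \<open>Lagrange's theorem over the rationals, by residues modulo 4 after removing a square. A
  number s with residue 1 is a sum of three squares already. For residue 2 use s - 1 and add 1. For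
  residue 3 treat 2s and halve.\<close>

lemma rat_four_squares_nat: "rat_four_squares (real n)"
proof (cases "n = 0")
  case False
  then obtain s t where st: "n = s * t\<^sup>2" "s mod 4 \<noteq> 0"
    using squarefree_decomposition[of n] by blast
  have "s mod 4 = 1 \<or> s mod 4 = 2 \<or> s mod 4 = 3" using st(2) by presburger
  then have "rat_four_squares (real s)"
  proof (elim disjE)
    assume "s mod 4 = 1"
    then show ?thesis using rat_four_squares_add_square[OF rat_three_squares_mod4, of s 0] by simp
  next
    assume "s mod 4 = 3"
    then have "(2 * s) mod 4 = 2" by presburger
    then show ?thesis using rat_four_squares_mod4[of "2 * s"] rat_four_squares_half by simp
  qed (rule rat_four_squares_mod4)
  then show ?thesis unfolding st(1) using rat_four_squares_scale[of "real s" "real t"] by simp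
qed (auto simp: rat_four_squares_def intro!: bexI[of _ 0])

lemma rat_four_squares_rat:
  assumes "r \<in> \<rat>" "r \<ge> 0" shows "rat_four_squares r"
proof -
  obtain m n :: nat where mn: "n \<noteq> 0" "\<bar>r\<bar> = real m / real n"
    using Rats_abs_nat_div_natE[OF assms(1)] by metis
  have "rat_four_squares (real (m * n) * (1 / real n)\<^sup>2)"
    by (rule rat_four_squares_scale[OF rat_four_squares_nat]) auto
  also have "real (m * n) * (1 / real n)\<^sup>2 = r" using mn assms(2) by (simp add: power2_eq_square)
  finally show ?thesis .
qed

section \<open>Orthogonal pairs of prescribed norms from quaternions\<close>

definition rat_orthogonal5 :: "real \<Rightarrow> real \<Rightarrow> bool" where
  "rat_orthogonal5 A B \<longleftrightarrow> (\<exists>f g. (\<forall>j<5::nat. f j \<in> \<rat> \<and> g j \<in> \<rat>) \<and>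
     (\<Sum>j<5. (f j)\<^sup>2) = A \<and> (\<Sum>j<5. (g j)\<^sup>2) = B \<and> (\<Sum>j<5. f j * g j) = 0)"

lemma sum_lessThan_5: "(\<Sum>j<5::nat. h j) = h 0 + h 1 + h 2 + h 3 + (h 4 :: real)"
  by (simp add: eval_nat_numeral)

lemma rat_orthogonal5_scale:
  assumes "rat_orthogonal5 A B" "s \<in> \<rat>" "t \<in> \<rat>"
  shows "rat_orthogonal5 (A * s\<^sup>2) (B * t\<^sup>2)"
proof -
  obtain f g where fg: "\<forall>j<5::nat. f j \<in> \<rat> \<and> g j \<in> \<rat>"
    "(\<Sum>j<5. (f j)\<^sup>2) = A" "(\<Sum>j<5. (g j)\<^sup>2) = B" "(\<Sum>j<5. f j * g j) = 0"
    using assms(1) unfolding rat_orthogonal5_def by blast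
  have "(\<Sum>j<5. f j * s * (g j * t)) = (\<Sum>j<5. f j * g j) * (s * t)"
    by (simp add: sum_distrib_left mult_ac)
  then show ?thesis unfolding rat_orthogonal5_def using fg assms(2,3)
    by (intro exI[of _ "\<lambda>j. f j * s"] exI[of _ "\<lambda>j. g j * t"])
       (auto simp: power_mult_distrib sum_distrib_right [symmetric])
qed

text \<open>
  Split \<open>\<rat>\<^sup>5 = \<rat> \<oplus> \<HH>\<close> with \<open>\<HH>\<close> the rational quaternions: the vectors \<open>(x, m)\<close> and \<open>(y, k)\<close> have
  norms \<open>A\<close>, \<open>B\<close> and are orthogonal iff \<open>|m|\<^sup>2 = A - x\<^sup>2\<close> and \<open>m\<^sup>* k\<close> has real part \<open>-x y\<close> and
  imaginary part of norm \<open>A B - A y\<^sup>2 - B x\<^sup>2\<close>.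
\<close>

lemma rat_orthogonal5_quaternion:
  assumes "A \<in> \<rat>" "x \<in> \<rat>" "y \<in> \<rat>" "x\<^sup>2 < A"
    and three: "rat_three_squares (A * B - A * y\<^sup>2 - B * x\<^sup>2)"
  shows "rat_orthogonal5 A B"
proof -
  obtain p q r where pqr: "p \<in> \<rat>" "q \<in> \<rat>" "r \<in> \<rat>" "A * B - A * y\<^sup>2 - B * x\<^sup>2 = p\<^sup>2 + q\<^sup>2 + r\<^sup>2"
    using three unfolding rat_three_squares_def by blast
  have "rat_four_squares (A - x\<^sup>2)"
    using assms by (intro rat_four_squares_rat) auto
  then obtain a b c d where m: "a \<in> \<rat>" "b \<in> \<rat>" "c \<in> \<rat>" "d \<in> \<rat>" "A - x\<^sup>2 = a\<^sup>2 + b\<^sup>2 + c\<^sup>2 + d\<^sup>2"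
    unfolding rat_four_squares_def by blast
  define N where "N = A - x\<^sup>2"
  have N: "N > 0" "N \<in> \<rat>" using assms by (auto simp: N_def)
  define h where "h = - (x * y)"
  \<comment> \<open>The four numbers are the components of the quaternion product of m = (a, b, c,
    d) and o = (h, p, q, r). Dividing by \<open>N\<close>, the norm of m, gives the k whose product
    with the conjugate of m is o.\<close>
  define k0 where "k0 = a * h - b * p - c * q - d * r"
  define k1 where "k1 = a * p + b * h + c * r - d * q"
  define k2 where "k2 = a * q - b * r + c * h + d * p"
  define k3 where "k3 = a * r + b * q - c * p + d * h"
  have kk: "k0\<^sup>2 + k1\<^sup>2 + k2\<^sup>2 + k3\<^sup>2 = (a\<^sup>2 + b\<^sup>2 + c\<^sup>2 + d\<^sup>2) * (h\<^sup>2 + (p\<^sup>2 + q\<^sup>2 + r\<^sup>2))"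
    unfolding k0_def k1_def k2_def k3_def by (simp add: power2_eq_square algebra_simps)
  have mk: "a * k0 + b * k1 + c * k2 + d * k3 = (a\<^sup>2 + b\<^sup>2 + c\<^sup>2 + d\<^sup>2) * h"
    unfolding k0_def k1_def k2_def k3_def by (simp add: power2_eq_square algebra_simps)
  have o2: "h\<^sup>2 + (p\<^sup>2 + q\<^sup>2 + r\<^sup>2) = N * (B - y\<^sup>2)"
    unfolding pqr(4) [symmetric] N_def h_def by (simp add: power2_eq_square algebra_simps)
  define f where "f = (\<lambda>j::nat. [x, a, b, c, d] ! j)"
  define g where "g = (\<lambda>j::nat. [y, k0 / N, k1 / N, k2 / N, k3 / N] ! j)"
  have rat: "\<forall>j<5. f j \<in> \<rat> \<and> g j \<in> \<rat>"
  proof -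
    have "h \<in> \<rat>" using assms by (simp add: h_def)
    then have "k0 \<in> \<rat>" "k1 \<in> \<rat>" "k2 \<in> \<rat>" "k3 \<in> \<rat>"
      using m pqr unfolding k0_def k1_def k2_def k3_def by (auto intro!: Rats_add Rats_diff Rats_mult)
    then show ?thesis using assms m N(2) by (auto simp: f_def g_def less_Suc_eq eval_nat_numeral)
  qed
  have 1: "(\<Sum>j<5. (f j)\<^sup>2) = A" using m(5) by (simp add: sum_lessThan_5 f_def eval_nat_numeral)
  have "(\<Sum>j<5. (g j)\<^sup>2) = y\<^sup>2 + (k0\<^sup>2 + k1\<^sup>2 + k2\<^sup>2 + k3\<^sup>2) / N\<^sup>2"
    by (simp add: sum_lessThan_5 g_def eval_nat_numeral power_divide add_divide_distrib)
  also have "\<dots> = y\<^sup>2 + (N * (N * (B - y\<^sup>2))) / N\<^sup>2"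
    unfolding kk o2 m(5) [symmetric] N_def [symmetric] ..
  also have "\<dots> = B" using N(1) by (simp add: power2_eq_square)
  finally have 2: "(\<Sum>j<5. (g j)\<^sup>2) = B" .
  have "(\<Sum>j<5. f j * g j) = x * y + (a * k0 + b * k1 + c * k2 + d * k3) / N"
    by (simp add: sum_lessThan_5 f_def g_def eval_nat_numeral add_divide_distrib)
  also have "\<dots> = x * y + N * h / N"
    unfolding mk m(5) [symmetric] N_def [symmetric] ..
  also have "\<dots> = 0" using N(1) by (simp add: h_def)
  finally have "(\<Sum>j<5. f j * g j) = 0" .
  with 1 2 rat show ?thesis unfolding rat_orthogonal5_def by blast
qed

text \<open>In each case \<open>x\<close> and \<open>y\<close> are picked so that the number
  required by \<open>rat_orthogonal5_quaternion\<close> is a rational square times an integer that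
  is 1 modulo 4. A norm with residue 3 calls for 1/2 as the coordinate whose square it multiplies;
  with residues 1 and 2, subtracting 1 from the even norm suffices.\<close>

lemma rat_orthogonal5_not_mod4:
  fixes A B :: nat assumes "A mod 4 \<noteq> 0" "B mod 4 \<noteq> 0"
  shows "rat_orthogonal5 A B"
proof -
  have pos: "A > 0" "B > 0" using assms by (auto intro: Nat.gr0I)
  have three: "rat_three_squares r" if "n mod 4 = 1" "t \<in> \<rat>" "r = real n * t\<^sup>2" for n :: nat and t r
    using rat_three_squares_scale[OF rat_three_squares_mod4[OF that(1)] that(2)] that(3) by simp
  have m4: "(4 * d - c) mod 4 = 1" if c: "c mod 4 = 3" "c \<le> 4 * d" for c d :: nat
  proof -
    have "c = 4 * (c div 4) + 3" using c(1) div_mult_mod_eq[of c 4] by simp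
    moreover from this obtain j where "d = Suc (c div 4) + j"
      using c(2) less_imp_Suc_add[of "c div 4" d] by auto
    ultimately have "4 * d - c = 4 * j + 1" by linarith
    then show ?thesis by simp
  qed
  have modmult: "(m * n) mod 4 = ((m mod 4) * (n mod 4)) mod 4" for m n :: nat by (simp add: mod_mult_eq)
  have cases: "k mod 4 = 1 \<or> k mod 4 = 2 \<or> k mod 4 = 3" if "k mod 4 \<noteq> 0" for k :: nat
    using that by presburger
  consider "A mod 4 = 3" | "B mod 4 = 3" | "A mod 4 = 1" "B mod 4 = 1" | "A mod 4 = 1" "B mod 4 = 2"
    | "A mod 4 = 2" "B mod 4 = 1" | "A mod 4 = 2" "B mod 4 = 2"
    using cases[OF assms(1)] cases[OF assms(2)] by blast
  then show ?thesis
  proof cases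
    case 1
    have le: "A \<le> 4 * (A * B)" using pos by simp
    have "(4 * (A * B) - A) mod 4 = 1" using 1 le by (rule m4)
    then have "rat_three_squares (real A * real B - real A * (1/2)\<^sup>2 - real B * 0\<^sup>2)"
      by (rule three[where t = "1/2"]) (use le in \<open>auto simp: of_nat_diff power2_eq_square field_simps\<close>)
    then show ?thesis by (rule rat_orthogonal5_quaternion[rotated -1]) (use pos in auto)
  next
    case 2
    have le: "B \<le> 4 * (A * B)" using pos by simp
    have "(4 * (A * B) - B) mod 4 = 1" using 2 le by (rule m4)
    then have "rat_three_squares (real A * real B - real A * 0\<^sup>2 - real B * (1/2)\<^sup>2)"
      by (rule three[where t = "1/2"]) (use le in \<open>auto simp: of_nat_diff power2_eq_square field_simps\<close>)
    then show ?thesis by (rule rat_orthogonal5_quaternion[rotated -1]) (use pos in \<open>auto simp: power2_eq_square\<close>)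
  next
    case 3
    then have "(A * B) mod 4 = 1" by (subst modmult) simp
    then have "rat_three_squares (real A * real B - real A * 0\<^sup>2 - real B * 0\<^sup>2)"
      by (rule three[where t = 1]) auto
    then show ?thesis by (rule rat_orthogonal5_quaternion[rotated -1]) (use pos in auto)
  next
    case 4
    obtain c where c: "B = Suc c" using pos by (cases B) auto
    then have "c mod 4 = 1" using 4 by presburger
    then have "(A * c) mod 4 = 1" using 4 by (subst modmult) simp
    then have "rat_three_squares (real A * real B - real A * 1\<^sup>2 - real B * 0\<^sup>2)"
      by (rule three[where t = 1]) (auto simp: c algebra_simps)
    then show ?thesis by (rule rat_orthogonal5_quaternion[rotated -1]) (use pos in auto)
  next
    case 5
    obtain c where c: "A = Suc c" using pos by (cases A) auto
    then have "c mod 4 = 1" using 5 by presburger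
    then have "c > 0" by (cases c) auto
    have "(B * c) mod 4 = 1" using 5 \<open>c mod 4 = 1\<close> by (subst modmult) simp
    then have "rat_three_squares (real A * real B - real A * 0\<^sup>2 - real B * 1\<^sup>2)"
      by (rule three[where t = 1]) (auto simp: c algebra_simps)
    then show ?thesis by (rule rat_orthogonal5_quaternion[rotated -1]) (use c \<open>c > 0\<close> in auto)
  next
    case 6
    define a b where "a = A div 2" and "b = B div 2"
    have ab: "A = 2 * a" "B = 2 * b" "odd a" "odd b" using 6 unfolding a_def b_def by presburger+
    have o: "k mod 4 = 1 \<or> k mod 4 = 3" if "odd k" for k :: nat using that by presburger
    consider "(a * b) mod 4 = 1" | "(a * b) mod 4 = 3"
      using o[of "a * b"] ab by auto
    then show ?thesis
    proof cases
      case 1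
      then have "rat_three_squares (real A * real B - real A * 0\<^sup>2 - real B * 0\<^sup>2)"
        by (rule three[where t = 2]) (use ab in auto)
      then show ?thesis by (rule rat_orthogonal5_quaternion[rotated -1]) (use pos in auto)
    next
      case 2
      \<comment> \<open>Here \<open>y = 2 / 3\<close> and \<open>x = 0\<close>: with A = 2a and B =
        2b the number is (2/3)^2 (9ab - 2a). As a is odd and ab is 3 modulo 4, the bracket is 1
        modulo 4.\<close>
      have le: "2 * a \<le> 9 * (a * b)"
        using ab by (cases b) auto
      define c e where "c = a * b" and "e = 9 * c - 2 * a"
      have "9 * c = e + 2 * a" "c mod 4 = 3" using le 2 by (simp_all add: c_def e_def)
      moreover obtain k where "a = 2 * k + 1" using ab(3) by (rule oddE)
      moreover obtain m where "c = 4 * m + 3"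
        using \<open>c mod 4 = 3\<close> div_mult_mod_eq[of c 4] by (metis mult.commute)
      ultimately have "e + 4 * k = 1 + 4 * (9 * m + 6)" by simp
      then have "(e + 4 * k) mod 4 = (1 + 4 * (9 * m + 6)) mod 4" by simp
      then have "e mod 4 = 1" by (simp del: distrib_left_numeral)
      then have "(9 * (a * b) - 2 * a) mod 4 = 1" by (simp add: c_def e_def)
      then have "rat_three_squares (real A * real B - real A * (2/3)\<^sup>2 - real B * 0\<^sup>2)"
        by (rule three[where t = "2/3"]) (use le ab in \<open>auto simp: of_nat_diff power2_eq_square field_simps\<close>)
      then show ?thesis by (rule rat_orthogonal5_quaternion[rotated -1]) (use pos in auto)
    qed
  qed
qed

lemma rat_orthogonal5_nat:
  fixes A B :: nat assumes "A > 0" "B > 0"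
  shows "rat_orthogonal5 A B"
proof -
  obtain s t where A: "A = s * t\<^sup>2" "s mod 4 \<noteq> 0" using squarefree_decomposition[OF assms(1)] by blast
  obtain s' t' where B: "B = s' * t'\<^sup>2" "s' mod 4 \<noteq> 0" using squarefree_decomposition[OF assms(2)] by blast
  have "rat_orthogonal5 (real s * (real t)\<^sup>2) (real s' * (real t')\<^sup>2)"
    by (intro rat_orthogonal5_scale rat_orthogonal5_not_mod4 A B) auto
  then show ?thesis by (simp add: A B)
qed

section \<open>Realizing angles\<close>

lemma nonzero_int_vecsD:
  assumes "a \<in> nonzero_int_vecs" shows "a $ i \<in> \<int>" "a \<noteq> 0"
  using assms by (auto simp: nonzero_int_vecs_def)

lemma inner_rat:
  fixes v w :: "real ^ 'n" assumes "\<And>i. v $ i \<in> \<rat>" "\<And>i. w $ i \<in> \<rat>" shows "v \<bullet> w \<in> \<rat>"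
  unfolding inner_vec_def using assms by (auto intro!: Rats_sum)

lemma inner_int:
  fixes v w :: "real ^ 'n" assumes "\<And>i. v $ i \<in> \<int>" "\<And>i. w $ i \<in> \<int>" shows "v \<bullet> w \<in> \<int>"
  unfolding inner_vec_def using assms by (auto intro!: Ints_sum)

lemma Ints_imp_Rats: "x \<in> \<int> \<Longrightarrow> x \<in> \<rat>"
  using Ints_subset_Rats by blast

lemma nonneg_Ints_nat:
  assumes "x \<in> \<int>" "x \<ge> (0::real)" shows "\<exists>n::nat. x = real n"
proof -
  obtain m where "x = of_int m" using assms(1) by (rule Ints_cases)
  with assms(2) show ?thesis by (intro exI[of _ "nat m"]) simp
qed

lemma common_denominator:
  fixes v :: "real ^ 'n" assumes "\<And>i. v $ i \<in> \<rat>"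
  obtains k :: nat where "k > 0" "\<And>i. real k * v $ i \<in> \<int>"
proof -
  have "\<exists>d::nat. d > 0 \<and> real d * v $ i \<in> \<int>" for i
  proof -
    obtain m n where "n > 0" "v $ i = of_int m / of_int n" using assms[of i] by (rule Rats_cases')
    then have "nat n > 0" "real (nat n) * v $ i = of_int m" by auto
    then show ?thesis by (metis Ints_of_int)
  qed
  then obtain d :: "'n \<Rightarrow> nat" where d: "\<And>i. d i > 0" "\<And>i. real (d i) * v $ i \<in> \<int>" by metis
  have "real (\<Prod>i\<in>UNIV. d i) * v $ j \<in> \<int>" for j
  proof -
    have "(\<Prod>i\<in>UNIV. d i) = (\<Prod>i\<in>UNIV - {j}. d i) * d j"
      by (subst prod.remove[of UNIV j]) (auto simp: mult.commute)
    then have "real (\<Prod>i\<in>UNIV. d i) * v $ j = real (\<Prod>i\<in>UNIV - {j}. d i) * (real (d j) * v $ j)"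
      by simp
    then show ?thesis using d(2)[of j] by (metis Ints_mult Ints_of_nat)
  qed
  moreover have "(\<Prod>i\<in>UNIV. d i) > 0" using d(1) by (auto intro: prod_pos)
  ultimately show ?thesis using that by blast
qed

text \<open>The vector \<open>b0\<close> satisfies
  \<open>a \<bullet> b0 = c * (a \<bullet> a)\<close>, and its length is the product of the lengths
  of \<open>a\<close>, \<open>u\<close> and \<open>v\<close>, so it has the right cosine with
  \<open>a\<close>. Clearing denominators by a positive factor keeps the angle.\<close>

lemma angle_transfer:
  fixes a u v w :: "real ^ 'n"
  assumes a: "a \<in> nonzero_int_vecs" and u: "u \<in> nonzero_int_vecs" and v: "v \<in> nonzero_int_vecs"
    and w: "\<And>i. w $ i \<in> \<rat>" "w \<bullet> a = 0" "w \<bullet> w = (a \<bullet> a) * ((u \<bullet> u) * (v \<bullet> v) - (u \<bullet> v)\<^sup>2)"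
  shows "\<exists>b \<in> nonzero_int_vecs. vec_angle a b = vec_angle u v"
proof -
  define c where "c = u \<bullet> v"
  define b0 where "b0 = c *\<^sub>R a + w"
  have c: "c \<in> \<rat>" unfolding c_def using u v nonzero_int_vecsD(1) by (intro inner_rat Ints_imp_Rats) auto
  have "b0 $ i \<in> \<rat>" for i
    unfolding b0_def using c w(1) Ints_imp_Rats[OF nonzero_int_vecsD(1)[OF a]] by (auto intro!: Rats_add Rats_mult)
  then obtain k :: nat where k: "k > 0" "\<And>i. real k * b0 $ i \<in> \<int>" using common_denominator by blast
  define b where "b = real k *\<^sub>R b0"
  have ab0: "a \<bullet> b0 = c * (a \<bullet> a)" using w(2) by (simp add: b0_def inner_right_distrib inner_commute)
  have "b0 \<bullet> b0 = c\<^sup>2 * (a \<bullet> a) + w \<bullet> w"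
    using w(2) by (simp add: b0_def inner_right_distrib inner_left_distrib inner_commute power2_eq_square)
  also have "\<dots> = (a \<bullet> a) * ((u \<bullet> u) * (v \<bullet> v))" unfolding w(3) c_def by (simp add: algebra_simps)
  finally have bb: "b0 \<bullet> b0 = (a \<bullet> a) * ((u \<bullet> u) * (v \<bullet> v))" .
  have nz: "a \<noteq> 0" "u \<noteq> 0" "v \<noteq> 0" using a u v nonzero_int_vecsD(2) by auto
  then have "b0 \<noteq> 0" using bb by (metis inner_eq_zero_iff inner_zero_left mult_eq_0_iff)
  then have "b \<in> nonzero_int_vecs" using k by (auto simp: b_def nonzero_int_vecs_def)
  moreover have "norm b0 = norm a * (norm u * norm v)"
    unfolding norm_eq_sqrt_inner bb by (simp add: real_sqrt_mult)
  then have "a \<bullet> b / (norm a * norm b) = u \<bullet> v / (norm u * norm v)"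
    using k nz unfolding b_def by (simp add: ab0 c_def dot_square_norm power2_eq_square)
  then have "vec_angle a b = vec_angle u v" by (simp add: vec_angle_def)
  ultimately show ?thesis by blast
qed

text \<open>Numbered coordinates: the bijective case expands scalar products in small dimensions,
  the injective case embeds five-dimensional pairs in higher ones.\<close>

lemma index_enumeration:
  assumes "k \<le> CARD('n::finite)"
  obtains e :: "nat \<Rightarrow> 'n::finite" where "inj_on e {..<k}" "k = CARD('n) \<Longrightarrow> bij_betw e {..<k} UNIV"
proof -
  obtain e :: "nat \<Rightarrow> 'n" where e: "bij_betw e {0..<CARD('n)} UNIV"
    using ex_bij_betw_nat_finite[of "UNIV :: 'n set"] by auto
  then have "inj_on e {..<k}" using assms by (auto simp: bij_betw_def intro: inj_on_subset)
  with that e show ?thesis by (auto simp: lessThan_atLeast0)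
qed

definition embed_coords :: "nat \<Rightarrow> (nat \<Rightarrow> 'n) \<Rightarrow> (nat \<Rightarrow> real) \<Rightarrow> real ^ 'n" where
  "embed_coords k e f = (\<Sum>j<k. f j *\<^sub>R axis (e j) 1)"

lemma inner_embed_coords:
  assumes "inj_on e {..<k}"
  shows "embed_coords k e f \<bullet> embed_coords k e g = (\<Sum>j<k. f j * g j)"
proof -
  have "embed_coords k e f \<bullet> embed_coords k e g = (\<Sum>i<k. \<Sum>j<k. f i * (g j * (if i = j then 1 else 0)))"
    unfolding embed_coords_def inner_sum_left inner_sum_right
    using assms by (intro sum.cong refl) (auto simp: inner_axis_axis inj_on_def)
  also have "\<dots> = (\<Sum>j<k. f j * g j)" by (simp add: if_distrib cong: if_cong)
  finally show ?thesis .
qed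

lemma embed_coords_in:
  assumes "\<And>j. j < k \<Longrightarrow> f j \<in> X" "0 \<in> X" and inj: "inj_on e {..<k}"
  shows "embed_coords k e f $ i \<in> X"
proof -
  have *: "embed_coords k e f $ i = (\<Sum>j<k. if i = e j then f j else 0)"
    by (simp add: embed_coords_def axis_def if_distrib cong: if_cong)
  show ?thesis
  proof (cases "\<exists>j<k. i = e j")
    case True
    then obtain j where j: "j < k" "i = e j" by blast
    have "(\<Sum>l<k. if i = e l then f l else 0) = (\<Sum>l<k. if l = j then f l else 0)"
      using j inj by (intro sum.cong) (auto simp: inj_on_def)
    also have "\<dots> = f j" using j by simp
    finally show ?thesis using * assms(1) j by simp
  next
    case False
    then have "(\<Sum>j<k. if i = e j then f j else 0) = 0" by (intro sum.neutral) auto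
    then show ?thesis using * assms(2) by simp
  qed
qed

lemma inner_enumeration:
  fixes v w :: "real ^ 'n" assumes "bij_betw e {..<k} (UNIV :: 'n set)"
  shows "v \<bullet> w = (\<Sum>j<k. v $ e j * w $ e j)"
  unfolding inner_vec_def using sum.reindex_bij_betw[OF assms, of "\<lambda>i. v $ i * w $ i"] by simp

lemma embed_coords_nth:
  assumes "inj_on e {..<k}" "j < k" shows "embed_coords k e f $ e j = f j"
proof -
  have "embed_coords k e f $ e j = (\<Sum>l<k. if l = j then f l else 0)"
    unfolding embed_coords_def sum_component
    using assms by (intro sum.cong) (auto simp: axis_def inj_on_def)
  then show ?thesis using assms by simp
qed

text \<open>Multiplication of \<open>a\<close> by \<open>Im (u\<^sup>* v)\<close>, in the complex numbers resp. the quaternions.\<close>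

lemma orthogonal_companion_2:
  fixes a u v :: "real ^ 'n"
  assumes "CARD('n) = 2" "\<And>i. a $ i \<in> \<rat>" "\<And>i. u $ i \<in> \<rat>" "\<And>i. v $ i \<in> \<rat>"
  shows "\<exists>w. (\<forall>i. w $ i \<in> \<rat>) \<and> w \<bullet> a = 0 \<and> w \<bullet> w = (a \<bullet> a) * ((u \<bullet> u) * (v \<bullet> v) - (u \<bullet> v)\<^sup>2)"
proof -
  obtain e :: "nat \<Rightarrow> 'n" where e: "inj_on e {..<2}" "bij_betw e {..<2} UNIV"
    using index_enumeration[where k = 2 and 'n = 'n] assms(1) by auto
  define q where "q = u $ e 0 * v $ e 1 - u $ e 1 * v $ e 0"
  define f where "f j = (if j = 0 then - (a $ e 1 * q) else a $ e 0 * q)" for j :: nat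
  define w where "w = embed_coords 2 e f"
  have inner: "x \<bullet> y = x $ e 0 * y $ e 0 + x $ e 1 * y $ e 1" for x y :: "real ^ 'n"
    using inner_enumeration[OF e(2), of x y] by (simp add: eval_nat_numeral)
  have w: "w $ e 0 = - (a $ e 1 * q)" "w $ e 1 = a $ e 0 * q"
    using embed_coords_nth[OF e(1)] by (auto simp: w_def f_def)
  have "q \<in> \<rat>" using assms by (auto simp: q_def)
  then have "w $ i \<in> \<rat>" for i unfolding w_def
    using assms by (intro embed_coords_in e) (auto simp: f_def)
  moreover have "w \<bullet> a = 0" by (simp add: inner w del: One_nat_def)
  moreover have "w \<bullet> w = (a \<bullet> a) * q\<^sup>2"
    by (simp add: inner w power2_eq_square algebra_simps del: One_nat_def)
  moreover have "q\<^sup>2 = (u \<bullet> u) * (v \<bullet> v) - (u \<bullet> v)\<^sup>2"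
    by (simp add: inner q_def power2_eq_square algebra_simps)
  ultimately show ?thesis by auto
qed

lemma orthogonal_companion_4:
  fixes a u v :: "real ^ 'n"
  assumes "CARD('n) = 4" "\<And>i. a $ i \<in> \<rat>" "\<And>i. u $ i \<in> \<rat>" "\<And>i. v $ i \<in> \<rat>"
  shows "\<exists>w. (\<forall>i. w $ i \<in> \<rat>) \<and> w \<bullet> a = 0 \<and> w \<bullet> w = (a \<bullet> a) * ((u \<bullet> u) * (v \<bullet> v) - (u \<bullet> v)\<^sup>2)"
proof -
  obtain e :: "nat \<Rightarrow> 'n" where e: "inj_on e {..<4}" "bij_betw e {..<4} UNIV"
    using index_enumeration[where k = 4 and 'n = 'n] assms(1) by auto
  have inner: "x \<bullet> y = x $ e 0 * y $ e 0 + x $ e 1 * y $ e 1 + x $ e 2 * y $ e 2 + x $ e 3 * y $ e 3" for x y :: "real ^ 'n"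
    using inner_enumeration[OF e(2), of x y] by (simp add: eval_nat_numeral)
  \<comment> \<open>Components of the imaginary part of the conjugate of \<open>u\<close> times
    \<open>v\<close>. The real part is \<open>u \<bullet> v\<close>, so multiplicativity of the norm
    makes the sum of their squares the Gram determinant. The list below is \<open>a\<close> times
    this imaginary quaternion, hence orthogonal to \<open>a\<close>.\<close>
  define q1 where "q1 = u $ e 0 * v $ e 1 - u $ e 1 * v $ e 0 - u $ e 2 * v $ e 3 + u $ e 3 * v $ e 2"
  define q2 where "q2 = u $ e 0 * v $ e 2 - u $ e 2 * v $ e 0 - u $ e 3 * v $ e 1 + u $ e 1 * v $ e 3"
  define q3 where "q3 = u $ e 0 * v $ e 3 - u $ e 3 * v $ e 0 - u $ e 1 * v $ e 2 + u $ e 2 * v $ e 1"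
  define f where "f = (\<lambda>j::nat. [
    - (a $ e 1 * q1) - a $ e 2 * q2 - a $ e 3 * q3,
    a $ e 0 * q1 + a $ e 2 * q3 - a $ e 3 * q2,
    a $ e 0 * q2 + a $ e 3 * q1 - a $ e 1 * q3,
    a $ e 0 * q3 + a $ e 1 * q2 - a $ e 2 * q1] ! j)"
  define w where "w = embed_coords 4 e f"
  have w: "w $ e 0 = - (a $ e 1 * q1) - a $ e 2 * q2 - a $ e 3 * q3"
    "w $ e 1 = a $ e 0 * q1 + a $ e 2 * q3 - a $ e 3 * q2"
    "w $ e 2 = a $ e 0 * q2 + a $ e 3 * q1 - a $ e 1 * q3"
    "w $ e 3 = a $ e 0 * q3 + a $ e 1 * q2 - a $ e 2 * q1"
    unfolding w_def by (subst embed_coords_nth[OF e(1)]; simp add: f_def)+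
  have q: "q1 \<in> \<rat>" "q2 \<in> \<rat>" "q3 \<in> \<rat>" using assms by (auto simp: q1_def q2_def q3_def)
  have "f j \<in> \<rat>" if "j < 4" for j
  proof -
    have "j = 0 \<or> j = 1 \<or> j = 2 \<or> j = 3" using that by arith
    then show ?thesis using assms q unfolding f_def by (elim disjE) (auto simp: eval_nat_numeral)
  qed
  then have "w $ i \<in> \<rat>" for i unfolding w_def by (intro embed_coords_in e) auto
  moreover have "w \<bullet> a = 0" by (simp add: inner w algebra_simps del: One_nat_def)
  moreover have "w \<bullet> w = (a \<bullet> a) * (q1\<^sup>2 + q2\<^sup>2 + q3\<^sup>2)"
    by (simp add: inner w power2_eq_square algebra_simps del: One_nat_def)
  moreover have "q1\<^sup>2 + q2\<^sup>2 + q3\<^sup>2 = (u \<bullet> u) * (v \<bullet> v) - (u \<bullet> v)\<^sup>2"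
    by (simp add: inner q1_def q2_def q3_def power2_eq_square algebra_simps)
  ultimately show ?thesis by auto
qed

text \<open>As \<open>a\<close> and \<open>a'\<close> have equal norm, the reflection along their
  difference moves \<open>a'\<close> to \<open>a\<close>. It is rational and preserves scalar
  products, so the image of \<open>w'\<close> serves.\<close>

lemma reflect_pair:
  fixes a a' w' :: "real ^ 'n"
  assumes "a' \<bullet> a' = a \<bullet> a" "w' \<bullet> a' = 0" "\<And>i. a $ i \<in> \<rat>" "\<And>i. a' $ i \<in> \<rat>" "\<And>i. w' $ i \<in> \<rat>"
  shows "\<exists>w. (\<forall>i. w $ i \<in> \<rat>) \<and> w \<bullet> a = 0 \<and> w \<bullet> w = w' \<bullet> w'"
proof (cases "a = a'")
  case True
  then show ?thesis using assms by blast
next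
  case False
  define d where "d = a - a'"
  have d0: "d \<bullet> d \<noteq> 0" using False by (simp add: d_def)
  define t where "t = 2 * (w' \<bullet> d) / (d \<bullet> d)"
  define w where "w = w' - t *\<^sub>R d"
  have dd: "d \<bullet> d = 2 * (d \<bullet> a)"
    using assms(1) by (simp add: d_def inner_diff_left inner_diff_right inner_commute)
  have td: "t * (d \<bullet> d) = 2 * (w' \<bullet> d)" using d0 by (simp add: t_def)
  have drat: "d $ i \<in> \<rat>" for i using assms by (simp add: d_def)
  then have "t \<in> \<rat>" unfolding t_def using assms by (intro Rats_divide Rats_mult inner_rat) auto
  then have "w $ i \<in> \<rat>" for i using assms drat by (simp add: w_def)
  moreover have "w \<bullet> a = 0"
  proof -
    have "w \<bullet> a = w' \<bullet> a - t * (d \<bullet> a)" by (simp add: w_def inner_diff_left)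
    also have "t * (d \<bullet> a) = w' \<bullet> d" using td dd by simp
    also have "w' \<bullet> a - w' \<bullet> d = w' \<bullet> a'" by (simp add: d_def inner_diff_right)
    finally show ?thesis using assms(2) by simp
  qed
  moreover have "w \<bullet> w = w' \<bullet> w' - t * (2 * (w' \<bullet> d)) + t * (t * (d \<bullet> d))"
    by (simp add: w_def inner_diff_left inner_diff_right inner_commute algebra_simps)
  then have "w \<bullet> w = w' \<bullet> w'" by (simp add: td)
  ultimately show ?thesis by blast
qed

text \<open>An orthogonal pair whose first norm is that of \<open>a\<close> is placed in five
  coordinates and then reflected so that its first vector becomes \<open>a\<close>.\<close>

lemma orthogonal_companion_ge5:
  fixes a :: "real ^ 'n" and D :: nat
  assumes "CARD('n) \<ge> 5" "a \<in> nonzero_int_vecs"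
  shows "\<exists>w. (\<forall>i. w $ i \<in> \<rat>) \<and> w \<bullet> a = 0 \<and> w \<bullet> w = (a \<bullet> a) * real D"
proof (cases "D = 0")
  case False
  obtain e :: "nat \<Rightarrow> 'n" where e: "inj_on e {..<5}"
    using index_enumeration[OF assms(1)] by blast
  have "a \<bullet> a \<in> \<int>" using assms(2) nonzero_int_vecsD(1) by (intro inner_int) auto
  moreover have apos: "a \<bullet> a > 0" using nonzero_int_vecsD(2)[OF assms(2)] by simp
  ultimately obtain A :: nat where A: "a \<bullet> a = real A" using nonneg_Ints_nat by (metis less_imp_le)
  then have "A > 0" using apos by simp
  then obtain f g where fg: "\<forall>j<5::nat. f j \<in> \<rat> \<and> g j \<in> \<rat>"
    "(\<Sum>j<5. (f j)\<^sup>2) = real A" "(\<Sum>j<5. (g j)\<^sup>2) = real (A * D)" "(\<Sum>j<5. f j * g j) = 0"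
    using rat_orthogonal5_nat[of A "A * D"] False unfolding rat_orthogonal5_def by auto
  have "\<exists>w. (\<forall>i. w $ i \<in> \<rat>) \<and> w \<bullet> a = 0 \<and> w \<bullet> w = embed_coords 5 e g \<bullet> embed_coords 5 e g"
  proof (rule reflect_pair[of "embed_coords 5 e f"])
    show "embed_coords 5 e f \<bullet> embed_coords 5 e f = a \<bullet> a"
      using fg(2) by (simp add: inner_embed_coords[OF e] A power2_eq_square)
    show "embed_coords 5 e g \<bullet> embed_coords 5 e f = 0"
      using fg(4) by (simp add: inner_embed_coords[OF e] mult.commute)
    show "a $ i \<in> \<rat>" for i using nonzero_int_vecsD(1)[OF assms(2)] by (rule Ints_imp_Rats)
    show "embed_coords 5 e f $ i \<in> \<rat>" "embed_coords 5 e g $ i \<in> \<rat>" for i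
      using fg(1) by (auto intro!: embed_coords_in e)
  qed
  also have "embed_coords 5 e g \<bullet> embed_coords 5 e g = (a \<bullet> a) * real D"
    using fg(3) by (simp add: inner_embed_coords[OF e] A power2_eq_square)
  finally show ?thesis .
qed (auto intro!: exI[of _ 0])

lemma angle_realizable:
  fixes a u v :: "real ^ 'n"
  assumes n: "CARD('n) \<noteq> 3"
    and a: "a \<in> nonzero_int_vecs" and u: "u \<in> nonzero_int_vecs" and v: "v \<in> nonzero_int_vecs"
  shows "\<exists>b \<in> nonzero_int_vecs. vec_angle a b = vec_angle u v"
proof -
  have rat: "a $ i \<in> \<rat>" "u $ i \<in> \<rat>" "v $ i \<in> \<rat>" for i
    using a u v nonzero_int_vecsD(1) Ints_imp_Rats by blast+
  have "CARD('n) > 0" by simp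
  then consider "CARD('n) = 1" | "CARD('n) = 2" | "CARD('n) = 4" | "CARD('n) \<ge> 5" using n by linarith
  then have "\<exists>w. (\<forall>i. w $ i \<in> \<rat>) \<and> w \<bullet> a = 0 \<and> w \<bullet> w = (a \<bullet> a) * ((u \<bullet> u) * (v \<bullet> v) - (u \<bullet> v)\<^sup>2)"
  proof cases
    case 1
    obtain e :: "nat \<Rightarrow> 'n" where e: "bij_betw e {..<1} UNIV"
      using index_enumeration[where k = 1 and 'n = 'n] 1 by auto
    have "(u \<bullet> u) * (v \<bullet> v) - (u \<bullet> v)\<^sup>2 = 0"
      by (simp add: inner_enumeration[OF e] power2_eq_square)
    then show ?thesis by (intro exI[of _ 0]) simp
  next
    case 2
    then show ?thesis using rat by (rule orthogonal_companion_2)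
  next
    case 3
    then show ?thesis using rat by (rule orthogonal_companion_4)
  next
    case 4
    have "(u \<bullet> u) * (v \<bullet> v) - (u \<bullet> v)\<^sup>2 \<in> \<int>"
      using u v nonzero_int_vecsD(1) by (auto intro!: Ints_diff Ints_mult Ints_power inner_int)
    moreover have "(u \<bullet> u) * (v \<bullet> v) - (u \<bullet> v)\<^sup>2 \<ge> 0"
      using Cauchy_Schwarz_ineq[of u v] by simp
    ultimately obtain D :: nat where "(u \<bullet> u) * (v \<bullet> v) - (u \<bullet> v)\<^sup>2 = real D"
      using nonneg_Ints_nat by metis
    then show ?thesis using orthogonal_companion_ge5[OF 4 a, of D] by simp
  qed
  then show ?thesis using angle_transfer[OF a u v] by blast
qed

section \<open>Obstructions in dimension three\<close>

lemma int_square_mod8: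
  fixes x :: int
  shows "odd x \<Longrightarrow> x\<^sup>2 mod 8 = 1" "even x \<Longrightarrow> x\<^sup>2 mod 8 = 0 \<or> x\<^sup>2 mod 8 = 4"
proof -
  assume "odd x"
  then have "x mod 8 = 1 \<or> x mod 8 = 3 \<or> x mod 8 = 5 \<or> x mod 8 = 7" by presburger
  then show "x\<^sup>2 mod 8 = 1" by (auto simp: power2_eq_square mod_mult_eq [symmetric, of x x])
next
  assume "even x"
  then have "x mod 8 = 0 \<or> x mod 8 = 2 \<or> x mod 8 = 4 \<or> x mod 8 = 6" by presburger
  then show "x\<^sup>2 mod 8 = 0 \<or> x\<^sup>2 mod 8 = 4" by (auto simp: power2_eq_square mod_mult_eq [symmetric, of x x])
qed

lemma mod_sum_three: "(p + q + r) mod m = (p mod m + q mod m + r mod m) mod (m :: int)"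
  by (metis mod_add_eq mod_mod_trivial)

lemma sum_three_int_squares_mod8:
  fixes x y z :: int
  shows "(x\<^sup>2 + y\<^sup>2 + z\<^sup>2) mod 8 = 3 \<Longrightarrow> odd x \<and> odd y \<and> odd z"
    and "(x\<^sup>2 + y\<^sup>2 + z\<^sup>2) mod 8 \<noteq> 7"
    and "(x\<^sup>2 + y\<^sup>2 + z\<^sup>2) mod 8 \<in> {0, 4} \<Longrightarrow> even x \<and> even y \<and> even z"
proof -
  have c: "odd t \<and> t\<^sup>2 mod 8 = 1 \<or> even t \<and> t\<^sup>2 mod 8 = 0 \<or> even t \<and> t\<^sup>2 mod 8 = 4" for t :: int
    using int_square_mod8[of t] by blast
  have m: "(x\<^sup>2 + y\<^sup>2 + z\<^sup>2) mod 8 = (x\<^sup>2 mod 8 + y\<^sup>2 mod 8 + z\<^sup>2 mod 8) mod 8"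
    by (rule mod_sum_three)
  show "(x\<^sup>2 + y\<^sup>2 + z\<^sup>2) mod 8 = 3 \<Longrightarrow> odd x \<and> odd y \<and> odd z"
    and "(x\<^sup>2 + y\<^sup>2 + z\<^sup>2) mod 8 \<noteq> 7"
    and "(x\<^sup>2 + y\<^sup>2 + z\<^sup>2) mod 8 \<in> {0, 4} \<Longrightarrow> even x \<and> even y \<and> even z"
    unfolding m using c[of x] c[of y] c[of z] by (elim disjE conjE; simp)+
qed

text \<open>Infinite descent on \<open>k\<close>: modulo 8, an even \<open>k\<close> forces \<open>x, y, z\<close> to be even.\<close>

lemma descent_three_squares:
  fixes x y z k m :: int
  assumes step: "\<And>x y z k. P x y z \<Longrightarrow> odd k \<Longrightarrow> x\<^sup>2 + y\<^sup>2 + z\<^sup>2 \<noteq> m * k\<^sup>2"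
    and half: "\<And>x y z. P (2 * x) (2 * y) (2 * z) \<Longrightarrow> P x y z"
  shows "P x y z \<Longrightarrow> x\<^sup>2 + y\<^sup>2 + z\<^sup>2 = m * k\<^sup>2 \<Longrightarrow> k = 0"
proof (induction "nat \<bar>k\<bar>" arbitrary: x y z k rule: less_induct)
  case less
  show ?case
  proof (rule ccontr)
    assume k0: "k \<noteq> 0"
    have "even k" using step less.prems by blast
    then obtain l where l: "k = 2 * l" by (rule evenE)
    have four: "4 * j mod 8 = 0 \<or> 4 * j mod 8 = 4" for j :: int by presburger
    have "(x\<^sup>2 + y\<^sup>2 + z\<^sup>2) mod 8 = 4 * (m * l\<^sup>2) mod 8"
      unfolding less.prems(2) l by (simp add: power_mult_distrib mult_ac)
    also have "\<dots> \<in> {0, 4}" using four[of "m * l\<^sup>2"] by blast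
    finally have "even x \<and> even y \<and> even z" by (rule sum_three_int_squares_mod8(3))
    then obtain x' y' z' where xyz: "x = 2 * x'" "y = 2 * y'" "z = 2 * z'" by (auto elim!: evenE)
    have "x'\<^sup>2 + y'\<^sup>2 + z'\<^sup>2 = m * l\<^sup>2"
      using less.prems(2) unfolding xyz l by (simp add: power_mult_distrib)
    moreover have "P x' y' z'" using less.prems(1) half unfolding xyz by blast
    moreover have "nat \<bar>l\<bar> < nat \<bar>k\<bar>" using k0 l by auto
    ultimately have "l = 0" using less.hyps by blast
    then show False using k0 l by simp
  qed
qed

lemma mult_odd_square_mod8:
  fixes m k :: int assumes "odd k" shows "(m * k\<^sup>2) mod 8 = m mod 8"
proof -
  have "(m * k\<^sup>2) mod 8 = (m * (k\<^sup>2 mod 8)) mod 8" by (simp add: mod_simps)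
  then show ?thesis using int_square_mod8(1)[OF assms] by simp
qed

lemma seven_mod8_not_three_squares:
  fixes x y z k m :: int
  assumes "m mod 8 = 7" "x\<^sup>2 + y\<^sup>2 + z\<^sup>2 = m * k\<^sup>2"
  shows "k = 0"
proof (rule descent_three_squares[where P = "\<lambda>_ _ _. True" and m = m])
  fix x y z k :: int assume "odd k"
  then show "x\<^sup>2 + y\<^sup>2 + z\<^sup>2 \<noteq> m * k\<^sup>2"
    using sum_three_int_squares_mod8(2)[of x y z] mult_odd_square_mod8[of k m] assms(1) by auto
qed (use assms in auto)

text \<open>For odd \<open>k\<close> the sum of squares is 3 modulo 8, which makes \<open>x\<close>,
  \<open>y\<close>, \<open>z\<close> odd. The scalar product then has the parity of
  \<open>a + b + c\<close> and cannot be 0. Orthogonality survives halving, as the descent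
  demands.\<close>

lemma orthogonal_norm_3_obstruction:
  fixes a b c x y z k :: int
  assumes "odd (a + b + c)" "a * x + b * y + c * z = 0" "x\<^sup>2 + y\<^sup>2 + z\<^sup>2 = 3 * k\<^sup>2"
  shows "k = 0"
proof (rule descent_three_squares[where P = "\<lambda>x y z. a * x + b * y + c * z = 0" and m = 3])
  fix x y z k :: int assume *: "a * x + b * y + c * z = 0" "odd k"
  show "x\<^sup>2 + y\<^sup>2 + z\<^sup>2 \<noteq> 3 * k\<^sup>2"
  proof
    assume "x\<^sup>2 + y\<^sup>2 + z\<^sup>2 = 3 * k\<^sup>2"
    then have "odd x \<and> odd y \<and> odd z"
      using sum_three_int_squares_mod8(1)[of x y z] mult_odd_square_mod8[OF *(2), of 3] by simp
    then have "odd (a * x + b * y + c * z)" using assms(1) by auto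
    then show False using *(1) by simp
  qed
next
  fix x y z :: int assume "a * (2 * x) + b * (2 * y) + c * (2 * z) = 0"
  then have "2 * (a * x + b * y + c * z) = 0" by (simp add: algebra_simps)
  then show "a * x + b * y + c * z = 0" by simp
qed (use assms in auto)

text \<open>
  If \<open>w\<close> is orthogonal to \<open>v = (a, b, c)\<close> then \<open>v \<times> w\<close> has norm \<open>|v|\<^sup>2 |w|\<^sup>2\<close>; for even \<open>|v|\<^sup>2\<close> the
  number \<open>D\<close> is chosen such that this product would be of the form \<open>4\<^sup>j (8 i + 7)\<close>.
\<close>

lemma orthogonal_norm_obstruction:
  fixes a b c :: int
  assumes "(a, b, c) \<noteq> (0, 0, 0)"
  shows "\<exists>D \<in> {2, 3, 6, 10, 14}. \<forall>x y z k. a * x + b * y + c * z = 0 \<longrightarrow>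
           x\<^sup>2 + y\<^sup>2 + z\<^sup>2 = D * k\<^sup>2 \<longrightarrow> k = 0"
  using assms
\<comment> \<open>The induction removes common factors 2 from \<open>(a, b, c)\<close>, which do not
  affect orthogonality.\<close>
proof (induction "nat (\<bar>a\<bar> + \<bar>b\<bar> + \<bar>c\<bar>)" arbitrary: a b c rule: less_induct)
  case less
  show ?case
  proof (cases "even a \<and> even b \<and> even c")
    case True
    then obtain a' b' c' where abc: "a = 2 * a'" "b = 2 * b'" "c = 2 * c'" by (auto elim!: evenE)
    have nz: "(a', b', c') \<noteq> (0, 0, 0)" using less.prems abc by auto
    then have "nat (\<bar>a'\<bar> + \<bar>b'\<bar> + \<bar>c'\<bar>) < nat (\<bar>a\<bar> + \<bar>b\<bar> + \<bar>c\<bar>)" unfolding abc by auto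
    note IH = less.hyps[OF this nz]
    have eq0: "a * x + b * y + c * z = 0 \<longleftrightarrow> a' * x + b' * y + c' * z = 0" for x y z
    proof -
      have "a * x + b * y + c * z = 2 * (a' * x + b' * y + c' * z)" by (simp add: abc algebra_simps)
      then show ?thesis by (simp del: distrib_left_numeral)
    qed
    show ?thesis using IH by (simp only: eq0)
  next
    case False
    show ?thesis
    proof (cases "odd (a + b + c)")
      case True
      then show ?thesis using orthogonal_norm_3_obstruction[OF True] by (intro bexI[of _ 3]) auto
    next
      case odd: False
      define A where "A = (a\<^sup>2 + b\<^sup>2 + c\<^sup>2) div 2"
      have par: "odd a \<and> odd b \<and> even c \<or> odd a \<and> even b \<and> odd c \<or> even a \<and> odd b \<and> odd c"
        using False odd by auto
      have m: "(a\<^sup>2 + b\<^sup>2 + c\<^sup>2) mod 8 = (a\<^sup>2 mod 8 + b\<^sup>2 mod 8 + c\<^sup>2 mod 8) mod 8"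
        by (rule mod_sum_three)
      have "(a\<^sup>2 + b\<^sup>2 + c\<^sup>2) mod 8 = 2 \<or> (a\<^sup>2 + b\<^sup>2 + c\<^sup>2) mod 8 = 6"
        unfolding m using par int_square_mod8[of a] int_square_mod8[of b] int_square_mod8[of c]
        by (elim disjE conjE) auto
      moreover have "s = 2 * (s div 2) \<and> odd (s div 2)" if "s mod 8 = 2 \<or> s mod 8 = 6" for s :: int
        using that by presburger
      ultimately have A: "a\<^sup>2 + b\<^sup>2 + c\<^sup>2 = 2 * A" "odd A" unfolding A_def by blast+
      have "A mod 8 = 1 \<or> A mod 8 = 3 \<or> A mod 8 = 5 \<or> A mod 8 = 7" using A(2) by presburger
      \<comment> \<open>Modulo 8 this is the negative of the odd number \<open>A\<close>, so
        \<open>A * d\<close> is congruent to -1.\<close>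
      moreover define d where "d = 8 - A mod 8"
      moreover have "(A * d) mod 8 = (A mod 8 * d) mod 8" by (simp add: mod_mult_left_eq)
      ultimately have d: "d \<in> {1, 3, 5, 7}" "(A * d) mod 8 = 7" by auto
      have obs: "k = 0" if "a * x + b * y + c * z = 0" "x\<^sup>2 + y\<^sup>2 + z\<^sup>2 = 2 * d * k\<^sup>2" for x y z k
      proof -
        \<comment> \<open>Lagrange's identity for the cross product. With the norms
          \<open>2 * A\<close> and \<open>2 * d * k\<^sup>2\<close> the factors 2 combine into a
          square.\<close>
        have "(b * z - c * y)\<^sup>2 + (c * x - a * z)\<^sup>2 + (a * y - b * x)\<^sup>2
                = (a\<^sup>2 + b\<^sup>2 + c\<^sup>2) * (x\<^sup>2 + y\<^sup>2 + z\<^sup>2) - (a * x + b * y + c * z)\<^sup>2"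
          by (simp add: power2_eq_square algebra_simps)
        also have "\<dots> = (A * d) * (2 * k)\<^sup>2"
          unfolding that A(1) by (simp add: power2_eq_square algebra_simps)
        finally have "2 * k = 0" using seven_mod8_not_three_squares[OF d(2)] by blast
        then show ?thesis by simp
      qed
      show ?thesis
      proof (rule bexI[of _ "2 * d"])
        show "\<forall>x y z k. a * x + b * y + c * z = 0 \<longrightarrow> x\<^sup>2 + y\<^sup>2 + z\<^sup>2 = 2 * d * k\<^sup>2 \<longrightarrow> k = 0"
          by (intro allI impI) (rule obs)
      qed (use d(1) in auto)
    qed
  qed
qed

text \<open>The scalar product must be nonzero: an orthogonal pair has a right angle, and that
  occurs at every lattice vector of dimension three.\<close>

lemma gram_witness_3:
  fixes D :: int assumes "D \<in> {2, 3, 6, 10, 14}"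
  shows "\<exists>u1 u2 u3 v1 v2 v3 :: int. u1 * v1 + u2 * v2 + u3 * v3 \<noteq> 0 \<and>
           (u1\<^sup>2 + u2\<^sup>2 + u3\<^sup>2) * (v1\<^sup>2 + v2\<^sup>2 + v3\<^sup>2) - (u1 * v1 + u2 * v2 + u3 * v3)\<^sup>2 = D"
proof -
  define ok :: "int \<Rightarrow> int \<Rightarrow> int \<Rightarrow> int \<Rightarrow> int \<Rightarrow> int \<Rightarrow> int \<Rightarrow> bool" where
    "ok E u1 u2 u3 v1 v2 v3 \<longleftrightarrow> u1 * v1 + u2 * v2 + u3 * v3 \<noteq> 0 \<and>
       (u1\<^sup>2 + u2\<^sup>2 + u3\<^sup>2) * (v1\<^sup>2 + v2\<^sup>2 + v3\<^sup>2) - (u1 * v1 + u2 * v2 + u3 * v3)\<^sup>2 = E"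
    for E u1 u2 u3 v1 v2 v3
  have "ok 2 1 0 0 1 1 1" "ok 3 1 1 0 0 1 1" "ok 6 1 1 0 1 3 1" "ok 10 1 0 0 1 3 1" "ok 14 1 1 (-1) 0 3 (-2)"
    by (simp_all add: ok_def)
  then show ?thesis using assms unfolding ok_def [symmetric] by blast
qed

lemma lattice_angles_at_subset:
  "a \<in> nonzero_int_vecs \<Longrightarrow> lattice_angles_at (a :: real ^ 'n) \<subseteq> lattice_angles TYPE('n)"
  unfolding lattice_angles_at_def lattice_angles_def by blast

text \<open>Take \<open>u\<close>, \<open>v\<close> with Gram determinant \<open>D\<close> forbidden
  for \<open>a\<close>. If \<open>b\<close> gave their angle at \<open>a\<close>, then with c =
  \<open>u \<bullet> v\<close> and p = \<open>a \<bullet> b\<close> equality of the squared cosines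
  makes c times the cross product of \<open>a\<close> and \<open>b\<close> a vector orthogonal to
  \<open>a\<close> of norm D p^2. The obstruction forces p = 0, contradicting that c is
  nonzero.\<close>

lemma angle_not_realizable_3:
  fixes a :: "real ^ 'n"
  assumes n: "CARD('n) = 3" and a: "a \<in> nonzero_int_vecs"
  shows "\<exists>u v :: real ^ 'n. u \<in> nonzero_int_vecs \<and> v \<in> nonzero_int_vecs \<and>
           (\<forall>b \<in> nonzero_int_vecs. vec_angle a b \<noteq> vec_angle u v)"
proof -
  obtain e :: "nat \<Rightarrow> 'n" where e: "inj_on e {..<3}" "bij_betw e {..<3} UNIV"
    using index_enumeration[where k = 3 and 'n = 'n] n by auto
  have inner: "x \<bullet> y = x $ e 0 * y $ e 0 + x $ e 1 * y $ e 1 + x $ e 2 * y $ e 2" for x y :: "real ^ 'n"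
    using inner_enumeration[OF e(2), of x y] by (simp add: eval_nat_numeral)
  have ints: "\<exists>x1 x2 x3 :: int. x $ e 0 = of_int x1 \<and> x $ e 1 = of_int x2 \<and> x $ e 2 = of_int x3"
    if "x \<in> nonzero_int_vecs" for x :: "real ^ 'n"
    using nonzero_int_vecsD(1)[OF that] by (metis Ints_cases)
  obtain a1 a2 a3 :: int where A: "a $ e 0 = of_int a1" "a $ e 1 = of_int a2" "a $ e 2 = of_int a3"
    using ints[OF a] by blast
  have "a \<bullet> a \<noteq> 0" using nonzero_int_vecsD(2)[OF a] by simp
  then have "(a1, a2, a3) \<noteq> (0, 0, 0)" using A by (auto simp: inner)
  from orthogonal_norm_obstruction[OF this] obtain D :: int where D: "D \<in> {2, 3, 6, 10, 14}"
    and "\<forall>x y z k. a1 * x + a2 * y + a3 * z = 0 \<longrightarrow> x\<^sup>2 + y\<^sup>2 + z\<^sup>2 = D * k\<^sup>2 \<longrightarrow> k = 0"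
    by (rule bexE)
  note obs = this(2)[rule_format]
  obtain u1 u2 u3 v1 v2 v3 :: int where c0: "u1 * v1 + u2 * v2 + u3 * v3 \<noteq> 0"
    and gram: "(u1\<^sup>2 + u2\<^sup>2 + u3\<^sup>2) * (v1\<^sup>2 + v2\<^sup>2 + v3\<^sup>2) - (u1 * v1 + u2 * v2 + u3 * v3)\<^sup>2 = D"
    using gram_witness_3[OF D] by blast
  define u where "u = embed_coords 3 e (\<lambda>j. of_int ([u1, u2, u3] ! j))"
  define v where "v = embed_coords 3 e (\<lambda>j. of_int ([v1, v2, v3] ! j))"
  have U: "u $ e 0 = of_int u1" "u $ e 1 = of_int u2" "u $ e 2 = of_int u3"
    unfolding u_def by (subst embed_coords_nth[OF e(1)]; simp)+
  have V: "v $ e 0 = of_int v1" "v $ e 1 = of_int v2" "v $ e 2 = of_int v3"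
    unfolding v_def by (subst embed_coords_nth[OF e(1)]; simp)+
  have uv: "u \<bullet> v = of_int (u1 * v1 + u2 * v2 + u3 * v3)" by (simp add: inner U V del: One_nat_def)
  have "u \<bullet> v \<noteq> 0" unfolding uv using c0 by (simp only: of_int_eq_0_iff not_False_eq_True)
  then have nz: "u \<noteq> 0" "v \<noteq> 0" by auto
  have "u $ i \<in> \<int>" "v $ i \<in> \<int>" for i
    unfolding u_def v_def by (auto intro!: embed_coords_in e)
  then have mem: "u \<in> nonzero_int_vecs" "v \<in> nonzero_int_vecs"
    using nz by (auto simp: nonzero_int_vecs_def)
  have "vec_angle a b \<noteq> vec_angle u v" if b: "b \<in> nonzero_int_vecs" for b
  proof
    assume eq: "vec_angle a b = vec_angle u v"
    \<comment> \<open>The function \<open>arccos\<close> is injective only on [-1, 1], so both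
      quotients must be known to lie there.\<close>
    have bound: "\<bar>x \<bullet> y / (norm x * norm y)\<bar> \<le> 1" for x y :: "real ^ 'n"
      using Cauchy_Schwarz_ineq2[of x y] by (cases "norm x * norm y = 0") (auto simp: abs_mult divide_le_eq)
    have "a \<bullet> b / (norm a * norm b) = u \<bullet> v / (norm u * norm v)"
      using eq bound[of a b] bound[of u v] arccos_eq_iff unfolding vec_angle_def by metis
    then have "a \<bullet> b * (norm u * norm v) = u \<bullet> v * (norm a * norm b)"
      using nz nonzero_int_vecsD(2)[OF a] nonzero_int_vecsD(2)[OF b] by (simp add: frac_eq_eq)
    then have "(a \<bullet> b)\<^sup>2 * ((norm u)\<^sup>2 * (norm v)\<^sup>2) = (u \<bullet> v)\<^sup>2 * ((norm a)\<^sup>2 * (norm b)\<^sup>2)"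
      by (metis power_mult_distrib)
    then have sq: "(a \<bullet> b)\<^sup>2 * ((u \<bullet> u) * (v \<bullet> v)) = (u \<bullet> v)\<^sup>2 * ((a \<bullet> a) * (b \<bullet> b))"
      by (simp only: power2_norm_eq_inner)
    obtain b1 b2 b3 :: int where B: "b $ e 0 = of_int b1" "b $ e 1 = of_int b2" "b $ e 2 = of_int b3"
      using ints[OF b] by blast
    define c where "c = u1 * v1 + u2 * v2 + u3 * v3"
    define p where "p = a1 * b1 + a2 * b2 + a3 * b3"
    have ab: "a \<bullet> b = of_int p" by (simp add: p_def inner A B del: One_nat_def)
    have aa: "a \<bullet> a = of_int (a1\<^sup>2 + a2\<^sup>2 + a3\<^sup>2)" by (simp add: inner A power2_eq_square del: One_nat_def)
    have bb: "b \<bullet> b = of_int (b1\<^sup>2 + b2\<^sup>2 + b3\<^sup>2)" by (simp add: inner B power2_eq_square del: One_nat_def)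
    have uu: "u \<bullet> u = of_int (u1\<^sup>2 + u2\<^sup>2 + u3\<^sup>2)" by (simp add: inner U power2_eq_square del: One_nat_def)
    have vv: "v \<bullet> v = of_int (v1\<^sup>2 + v2\<^sup>2 + v3\<^sup>2)" by (simp add: inner V power2_eq_square del: One_nat_def)
    have sqi: "p\<^sup>2 * ((u1\<^sup>2 + u2\<^sup>2 + u3\<^sup>2) * (v1\<^sup>2 + v2\<^sup>2 + v3\<^sup>2)) = c\<^sup>2 * ((a1\<^sup>2 + a2\<^sup>2 + a3\<^sup>2) * (b1\<^sup>2 + b2\<^sup>2 + b3\<^sup>2))"
      using sq unfolding ab aa bb uu vv uv c_def [symmetric] of_int_power [symmetric] of_int_mult [symmetric] of_int_eq_iff .
    define x where "x = c * (a2 * b3 - a3 * b2)"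
    define y where "y = c * (a3 * b1 - a1 * b3)"
    define z where "z = c * (a1 * b2 - a2 * b1)"
    have "a1 * x + a2 * y + a3 * z = 0" by (simp add: x_def y_def z_def algebra_simps)
    moreover have "x\<^sup>2 + y\<^sup>2 + z\<^sup>2 = c\<^sup>2 * ((a1\<^sup>2 + a2\<^sup>2 + a3\<^sup>2) * (b1\<^sup>2 + b2\<^sup>2 + b3\<^sup>2)) - c\<^sup>2 * p\<^sup>2"
      by (simp add: x_def y_def z_def p_def power2_eq_square algebra_simps)
    then have "x\<^sup>2 + y\<^sup>2 + z\<^sup>2 = D * p\<^sup>2"
      unfolding sqi [symmetric] gram [symmetric] c_def [symmetric] by (simp add: algebra_simps)
    ultimately have "p = 0" by (rule obs)
    then have "(u \<bullet> v)\<^sup>2 * ((a \<bullet> a) * (b \<bullet> b)) = 0" using sq ab by simp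
    then show False using \<open>u \<bullet> v \<noteq> 0\<close> nonzero_int_vecsD(2)[OF a] nonzero_int_vecsD(2)[OF b] by simp
  qed
  then show ?thesis using mem by (intro exI[of _ u] exI[of _ v]) simp
qed

theorem theorem1p3:
  shows "(CARD('n::finite) \<noteq> 3 \<longrightarrow>
            (\<forall>a \<in> (nonzero_int_vecs :: (real ^ 'n) set).
               lattice_angles_at a = lattice_angles TYPE('n)))
       \<and> (CARD('n) = 3 \<longrightarrow>
            (\<forall>a \<in> (nonzero_int_vecs :: (real ^ 'n) set).
               lattice_angles_at a \<subset> lattice_angles TYPE('n)))"
proof (intro conjI impI ballI)
  fix a :: "real ^ 'n" assume n: "CARD('n) \<noteq> 3" and a: "a \<in> nonzero_int_vecs"
  show "lattice_angles_at a = lattice_angles TYPE('n)"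
  proof
    show "lattice_angles TYPE('n) \<subseteq> lattice_angles_at a"
    proof
      fix t assume "t \<in> lattice_angles TYPE('n)"
      then obtain u v :: "real ^ 'n" where "u \<in> nonzero_int_vecs" "v \<in> nonzero_int_vecs" "t = vec_angle u v"
        unfolding lattice_angles_def by blast
      then show "t \<in> lattice_angles_at a"
        using angle_realizable[OF n a, of u v] unfolding lattice_angles_at_def by force
    qed
  qed (rule lattice_angles_at_subset[OF a])
next
  fix a :: "real ^ 'n" assume n: "CARD('n) = 3" and a: "a \<in> nonzero_int_vecs"
  obtain u v :: "real ^ 'n" where uv: "u \<in> nonzero_int_vecs" "v \<in> nonzero_int_vecs"
    "\<forall>b \<in> nonzero_int_vecs. vec_angle a b \<noteq> vec_angle u v"
    using angle_not_realizable_3[OF n a] by blast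
  then have "vec_angle u v \<in> lattice_angles TYPE('n)" "vec_angle u v \<notin> lattice_angles_at a"
    unfolding lattice_angles_def lattice_angles_at_def by (blast, force)
  then show "lattice_angles_at a \<subset> lattice_angles TYPE('n)"
    using lattice_angles_at_subset[OF a] by blast
qed

end
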